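(* Let $n\ge1$, $s\in(0,1)$, let $\Omega\subset\mathbb{R}^n$ be a bounded domain, let $\psi_1,\psi_2$ be measurable functions on $\Omega$ such that $K^s_{\psi_1}$ and $K^s_{\psi_2}$ are not empty, let $f\in\widetilde H^s(\Omega)'$, and let $u_i$ be the solution to $\mathcal P(\psi_i,f)$, $i=1,2$. If $\psi_1-\psi_2\in L^\infty(\Omega)$, then $u_1-u_2$ is bounded on $\Omega$, and (i) $\|(u_1-u_2)^+\|_\infty\le\|(\psi_1-\psi_2)^+\|_\infty$; (ii) $\|(u_1-u_2)^-\|_\infty\le\|(\psi_1-\psi_2)^-\|_\infty$, where $\|\cdot\|_\infty$ is the norm of $L^\infty(\Omega)$.
   Context: No regularity of $\partial\Omega$ is assumed. The fractional Laplacian is defined through the Fourier transform, $\mathcal F[(-\Delta)^s u]=|\xi|^{2s}\mathcal F[u]$. $H^s(\mathbb{R}^n)=\{u\in L^2(\mathbb{R}^n): (-\Delta)^{s/2}u\in L^2(\mathbb{R}^n)\}$ and $\widetilde H^s(\Omega)=\{u\in H^s(\mathbb{R}^n): u=0 \text{ a.e. on }\mathbb{R}^n\setminus\overline\Omega\}$, a Hilbert space with norm $\|(-\Delta)^{s/2}u\|_{L^2(\mathbb{R}^n)}$; $\widetilde H^s(\Omega)'$ is its dual and $\langle\cdot,\cdot\rangle$ the duality product. For $u\in\widetilde H^s(\Omega)$, $\langle(-\Delta)^s u,v\rangle=\int_{\mathbb{R}^n}(-\Delta)^{s/2}u\,(-\Delta)^{s/2}v\,dx$. For a measurable $\psi$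 on $\Omega$ let $K^s_\psi=\{v\in\widetilde H^s(\Omega): v\ge\psi\text{ a.e. on }\Omega\}$. The problem $\mathcal P(\psi,f)$ is: find $u\in K^s_\psi$ such that $\langle(-\Delta)^s u-f,v-u\rangle\ge0$ for all $v\in K^s_\psi$. When $K^s_\psi\neq\emptyset$ it has a unique solution. Notation: $v^+=\max\{v,0\}$, $v^-=-\min\{v,0\}$. *)

theory Defs
  imports "HOL-Analysis.Analysis" "HOL-Probability.Essential_Supremum"
begin

text \<open>
  Elements of Lebesgue spaces are represented by Lebesgue measurable functions; all notions below
  are invariant under modification on null sets.
\<close>

definition L2_space :: "('a::euclidean_space \<Rightarrow> 'b::euclidean_space) set" where
  "L2_space = {f. f \<in> borel_measurable lebesgue \<and> integrable lebesgue (\<lambda>x. (norm (f x))\<^sup>2)}"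

definition L2_norm :: "('a::euclidean_space \<Rightarrow> 'b::euclidean_space) \<Rightarrow> real" where
  "L2_norm f = sqrt (LINT x|lebesgue. (norm (f x))\<^sup>2)"

text \<open>
  The unitary Fourier transform, first as an integral and then on \<open>L\<^sup>2\<close>. On \<open>L\<^sup>2\<close> it is a
  relation, since the transform is determined only up to a null set: it is the \<open>L\<^sup>2\<close> limit of the
  Fourier integrals of the truncations of \<open>f\<close> to balls (which are integrable). The limit is
  expressed by the nonnegative integral, as the Bochner integral of a function that is
  not integrable is zero.
\<close>

definition fourier_integral :: "('a::euclidean_space \<Rightarrow> complex) \<Rightarrow> 'a \<Rightarrow> complex" where
  "fourier_integral f \<xi> =
     (2 * pi) powr (- real DIM('a) / 2) *\<^sub>R (LINT x|lebesgue. cis (- (x \<bullet> \<xi>)) * f x)"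

definition is_fourier_L2 ::
    "('a::euclidean_space \<Rightarrow> complex) \<Rightarrow> ('a \<Rightarrow> complex) \<Rightarrow> bool" where
  "is_fourier_L2 f g \<longleftrightarrow> f \<in> L2_space \<and> g \<in> L2_space \<and>
     (\<lambda>k. \<integral>\<^sup>+\<xi>. ennreal ((norm (fourier_integral
             (\<lambda>x. indicator (ball 0 (real k)) x *\<^sub>R f x) \<xi> - g \<xi>))\<^sup>2) \<partial>lebesgue)
        \<longlonglongrightarrow> 0"

text \<open>
  \<open>is_frac_laplacian s u w\<close> says that \<open>u\<close> and \<open>w\<close> are in \<open>L\<^sup>2\<close> and \<open>(-\<Delta>)\<^sup>s u = w\<close>, that is,
  the Fourier transform of \<open>w\<close> is \<open>\<bar>\<xi>\<bar>\<^sup>2\<^sup>s\<close> times that of \<open>u\<close>. Such a \<open>w\<close> is unique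
  up to a null set, and \<open>frac_laplacian\<close> picks a representative.
\<close>

definition is_frac_laplacian ::
    "real \<Rightarrow> ('a::euclidean_space \<Rightarrow> real) \<Rightarrow> ('a \<Rightarrow> real) \<Rightarrow> bool" where
  "is_frac_laplacian s u w \<longleftrightarrow>
     (\<exists>g. is_fourier_L2 (\<lambda>x. complex_of_real (u x)) g \<and>
          is_fourier_L2 (\<lambda>x. complex_of_real (w x)) (\<lambda>\<xi>. (norm \<xi> powr (2 * s)) *\<^sub>R g \<xi>))"

definition frac_laplacian ::
    "real \<Rightarrow> ('a::euclidean_space \<Rightarrow> real) \<Rightarrow> 'a \<Rightarrow> real" where
  "frac_laplacian s u = (SOME w. is_frac_laplacian s u w)"

definition Hs :: "real \<Rightarrow> ('a::euclidean_space \<Rightarrow> real) set" where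
  "Hs s = {u \<in> L2_space. \<exists>w \<in> L2_space. is_frac_laplacian (s / 2) u w}"

definition Hs_tilde :: "real \<Rightarrow> 'a::euclidean_space set \<Rightarrow> ('a \<Rightarrow> real) set" where
  "Hs_tilde s \<Omega> = {u \<in> Hs s. AE x in lebesgue. x \<notin> closure \<Omega> \<longrightarrow> u x = 0}"

definition Hs_tilde_norm :: "real \<Rightarrow> ('a::euclidean_space \<Rightarrow> real) \<Rightarrow> real" where
  "Hs_tilde_norm s u = L2_norm (frac_laplacian (s / 2) u)"

text \<open>
  Bounded linear functionals. Functions that agree almost everywhere have the same image,
  by linearity and boundedness.
\<close>

definition Hs_tilde_dual ::
    "real \<Rightarrow> 'a::euclidean_space set \<Rightarrow> (('a \<Rightarrow> real) \<Rightarrow> real) set" where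
  "Hs_tilde_dual s \<Omega> = {f.
     (\<forall>u \<in> Hs_tilde s \<Omega>. \<forall>v \<in> Hs_tilde s \<Omega>. f (\<lambda>x. u x + v x) = f u + f v) \<and>
     (\<forall>c. \<forall>u \<in> Hs_tilde s \<Omega>. f (\<lambda>x. c * u x) = c * f u) \<and>
     (\<exists>C. \<forall>u \<in> Hs_tilde s \<Omega>. \<bar>f u\<bar> \<le> C * Hs_tilde_norm s u)}"

text \<open>\<open>(-\<Delta>)\<^sup>s u\<close> as an element of the dual; the duality product is function application.\<close>

definition frac_laplacian_dual ::
    "real \<Rightarrow> ('a::euclidean_space \<Rightarrow> real) \<Rightarrow> ('a \<Rightarrow> real) \<Rightarrow> real" where
  "frac_laplacian_dual s u v =
     (LINT x|lebesgue. frac_laplacian (s / 2) u x * frac_laplacian (s / 2) v x)"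

definition K_obstacle ::
    "real \<Rightarrow> 'a::euclidean_space set \<Rightarrow> ('a \<Rightarrow> real) \<Rightarrow> ('a \<Rightarrow> real) set" where
  "K_obstacle s \<Omega> \<psi> = {v \<in> Hs_tilde s \<Omega>. AE x in lebesgue_on \<Omega>. \<psi> x \<le> v x}"

definition solves_obstacle_problem ::
    "real \<Rightarrow> 'a::euclidean_space set \<Rightarrow> ('a \<Rightarrow> real) \<Rightarrow> (('a \<Rightarrow> real) \<Rightarrow> real) \<Rightarrow> ('a \<Rightarrow> real) \<Rightarrow> bool"
  where
  "solves_obstacle_problem s \<Omega> \<psi> f u \<longleftrightarrow>
     u \<in> K_obstacle s \<Omega> \<psi> \<and>
     (\<forall>v \<in> K_obstacle s \<Omega> \<psi>.
        frac_laplacian_dual s u (\<lambda>x. v x - u x) - f (\<lambda>x. v x - u x) \<ge> 0)"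

definition Linf_norm :: "'a::euclidean_space set \<Rightarrow> ('a \<Rightarrow> real) \<Rightarrow> ereal" where
  "Linf_norm \<Omega> g = esssup (lebesgue_on \<Omega>) (\<lambda>x. ereal \<bar>g x\<bar>)"

definition Linf_space :: "'a::euclidean_space set \<Rightarrow> ('a \<Rightarrow> real) set" where
  "Linf_space \<Omega> = {g \<in> borel_measurable (lebesgue_on \<Omega>). Linf_norm \<Omega> g < \<infinity>}"

end

theory Submission
  imports Defs "HOL-Probability.Characteristic_Functions"
begin

text \<open>
  Write \<open>E(u, v)\<close> for the form \<open>\<langle>(-\<Delta>)\<^sup>s u, v\<rangle>\<close>. Let \<open>w = u1 - u2\<close>, let \<open>M \<ge> 0\<close> be an upper bound of
  \<open>\<psi>1 - \<psi>2\<close> on \<open>\<Omega>\<close>, and let \<open>\<phi> = max (w - M) 0\<close>. Since \<open>M \<ge> 0\<close>, the function \<open>\<phi>\<close> vanishes outside the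
  closure of \<open>\<Omega>\<close>. The functions \<open>u1 - \<phi>\<close> and \<open>u2 + \<phi>\<close> are admissible in the two obstacle problems, and
  adding the two variational inequalities eliminates the functional \<open>f\<close> and gives \<open>E(w, \<phi>) \<le> 0\<close>. On the other hand
  \<open>E(\<phi>, \<phi>) \<le> E(w, \<phi>)\<close>, so that \<open>\<phi> = 0\<close> and \<open>w \<le> M\<close> on \<open>\<Omega>\<close> (\<open>obstacle_comparison\<close>). Taking for \<open>M\<close> the norm of the
  positive part of \<open>\<psi>1 - \<psi>2\<close> gives the first estimate, and exchanging the two problems gives the second.

  That \<open>\<phi>\<close> belongs to \<open>Hs_tilde s \<Omega>\<close>, and that \<open>E(\<phi>, \<phi>) \<le> E(w, \<phi>)\<close>, both follow from one
  contraction property: composition with a function \<open>\<eta>\<close> of Lipschitz constant \<open>1\<close> that fixes \<open>0\<close> does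
  not increase the energy \<open>E(u, u)\<close> (\<open>fractional_energy_Lipschitz\<close>). For the membership, \<open>\<eta> t = max (t - M) 0\<close>;
  for the inequality, \<open>\<eta>\<close> is the reflection \<open>t - 2 * max (t - M) 0\<close>, which yields
  \<open>E(w - 2\<phi>, w - 2\<phi>) \<le> E(w, w)\<close> (\<open>frac_laplacian_dual_excess\<close>). The contraction property
  is plain once the energy is a positive superposition of the squared norms of the increments
  \<open>u(x + h) - u(x)\<close> (\<open>fractional_energy_jump\<close>), because \<open>\<eta>\<close> shrinks each increment. This representation
  comes from Plancherel's identity for the increments, together with the fact that a suitable average of
  \<open>\<bar>exp (i h \<bullet> \<xi>) - 1\<bar>\<^sup>2\<close> over \<open>h\<close> is a multiple of \<open>\<bar>\<xi>\<bar>\<^sup>2\<^sup>s\<close>; here \<open>0 < s < 1\<close> is what makes the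
  average finite.

  The fractional Laplacian is defined through the Fourier transform on \<open>L\<^sup>2\<close>, so two facts about that
  transform carry the rest: it is an isometry (\<open>Plancherel\<close>, \<open>is_fourier_L2_isometry\<close>), and every Hermitian
  Borel function in \<open>L\<^sup>2\<close> is the transform of a real one (\<open>is_fourier_L2_surj\<close>). The second
  produces \<open>(-\<Delta>)\<^sup>s\<^sup>/\<^sup>2 \<phi>\<close> as a function once its energy is known to be finite. Plancherel's identity is
  proved by Gaussian regularisation of the autocorrelation of an integrable function, and
  surjectivity rests on the completeness of \<open>L\<^sup>2\<close>.
\<close>

section \<open>The Hilbert space of square-integrable functions\<close>

definition L2_inner :: "('a::euclidean_space \<Rightarrow> 'b::euclidean_space) \<Rightarrow> ('a \<Rightarrow> 'b) \<Rightarrow> real" where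
  "L2_inner f g = (LINT x|lebesgue. f x \<bullet> g x)"

lemma L2_norm_eq_sqrt_inner: "L2_norm f = sqrt (L2_inner f f)"
  unfolding L2_norm_def L2_inner_def by (simp add: power2_norm_eq_inner)

lemma L2_inner_self_nonneg: "0 \<le> L2_inner f f"
  unfolding L2_inner_def by simp

lemma L2_norm_power2: "(L2_norm f)\<^sup>2 = L2_inner f f"
  by (simp add: L2_norm_eq_sqrt_inner L2_inner_self_nonneg)

lemma L2_norm_nonneg: "0 \<le> L2_norm f"
  by (simp add: L2_norm_eq_sqrt_inner L2_inner_self_nonneg)

lemma L2_space_measurable: "f \<in> L2_space \<Longrightarrow> f \<in> borel_measurable lebesgue"
  by (simp add: L2_space_def)

lemma integrable_L2_inner:
  assumes "f \<in> L2_space" "g \<in> L2_space"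
  shows "integrable lebesgue (\<lambda>x. f x \<bullet> g x)"
proof (rule Bochner_Integration.integrable_bound)
  show "integrable lebesgue (\<lambda>x. (norm (f x))\<^sup>2 + (norm (g x))\<^sup>2)"
    using assms by (auto simp: L2_space_def)
  show "(\<lambda>x. f x \<bullet> g x) \<in> borel_measurable lebesgue"
    using assms by (auto simp: L2_space_def)
  have "\<bar>f x \<bullet> g x\<bar> \<le> (norm (f x))\<^sup>2 + (norm (g x))\<^sup>2" for x
  proof -
    have "\<bar>f x \<bullet> g x\<bar> \<le> norm (f x) * norm (g x)" by (rule Cauchy_Schwarz_ineq2)
    also have "\<dots> \<le> (norm (f x))\<^sup>2 + (norm (g x))\<^sup>2"
      using sum_squares_bound[of "norm (f x)" "norm (g x)"]
        mult_nonneg_nonneg[OF norm_ge_zero[of "f x"] norm_ge_zero[of "g x"]]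
      by (simp only: mult.assoc)
    finally show ?thesis .
  qed
  then show "AE x in lebesgue. norm (f x \<bullet> g x) \<le> norm ((norm (f x))\<^sup>2 + (norm (g x))\<^sup>2)"
    by (auto intro!: AE_I2)
qed

lemma L2_space_scaleR:
  assumes "f \<in> L2_space" shows "(\<lambda>x. c *\<^sub>R f x) \<in> L2_space"
  using assms by (auto simp: L2_space_def power_mult_distrib)

lemma L2_space_add:
  assumes f: "f \<in> L2_space" and g: "g \<in> L2_space" shows "(\<lambda>x. f x + g x) \<in> L2_space"
proof -
  have eq: "(\<lambda>x. (norm (f x + g x))\<^sup>2) = (\<lambda>x. (norm (f x))\<^sup>2 + 2 * (f x \<bullet> g x) + (norm (g x))\<^sup>2)"
    by (simp add: fun_eq_iff power2_norm_eq_inner inner_add_left inner_add_right inner_commute)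
  have "integrable lebesgue (\<lambda>x. (norm (f x))\<^sup>2 + 2 * (f x \<bullet> g x) + (norm (g x))\<^sup>2)"
    using f g integrable_L2_inner[OF f g] unfolding L2_space_def
    by (intro Bochner_Integration.integrable_add integrable_mult_right) auto
  with f g show ?thesis
    unfolding L2_space_def mem_Collect_eq eq by (intro conjI borel_measurable_add) auto
qed

lemma L2_space_diff:
  assumes f: "f \<in> L2_space" and g: "g \<in> L2_space" shows "(\<lambda>x. f x - g x) \<in> L2_space"
  using L2_space_add[OF f L2_space_scaleR[OF g, of "-1"]] by simp

lemma L2_space_zero: "(\<lambda>x. 0) \<in> L2_space"
  by (simp add: L2_space_def)

lemma L2_space_bound:
  assumes "f \<in> L2_space" "g \<in> borel_measurable lebesgue"
    and "AE x in lebesgue. norm (g x) \<le> norm (f x)"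
  shows "g \<in> L2_space"
proof -
  have "integrable lebesgue (\<lambda>x. (norm (g x))\<^sup>2)"
  proof (rule Bochner_Integration.integrable_bound)
    show "integrable lebesgue (\<lambda>x. (norm (f x))\<^sup>2)" using assms by (simp add: L2_space_def)
    show "AE x in lebesgue. norm ((norm (g x))\<^sup>2) \<le> norm ((norm (f x))\<^sup>2)"
      using assms(3) by eventually_elim (simp add: power_mono)
  qed (use assms in measurable)
  with assms show ?thesis by (simp add: L2_space_def)
qed

lemma L2_space_cong_AE:
  assumes "f \<in> L2_space" "g \<in> borel_measurable lebesgue" "AE x in lebesgue. g x = f x"
  shows "g \<in> L2_space"
  by (rule L2_space_bound[OF assms(1,2)]) (use assms(3) in eventually_elim, simp)

lemma L2_space_indicator:
  assumes "f \<in> L2_space" "A \<in> sets lebesgue"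
  shows "(\<lambda>x. indicator A x *\<^sub>R f x) \<in> L2_space"
  by (rule L2_space_bound[OF assms(1)])
    (use assms in \<open>auto simp: L2_space_def indicator_def\<close>)

lemma L2_space_iff_nn_integral:
  "f \<in> L2_space \<longleftrightarrow> f \<in> borel_measurable lebesgue \<and> (\<integral>\<^sup>+x. ennreal ((norm (f x))\<^sup>2) \<partial>lebesgue) < \<infinity>"
  by (auto simp: L2_space_def integrable_iff_bounded)

lemma nn_integral_eq_L2_norm:
  assumes "f \<in> L2_space"
  shows "(\<integral>\<^sup>+x. ennreal ((norm (f x))\<^sup>2) \<partial>lebesgue) = ennreal ((L2_norm f)\<^sup>2)"
  using assms by (simp add: L2_space_def L2_norm_def nn_integral_eq_integral)

lemma L2_norm_cong_AE:
  assumes "f \<in> borel_measurable lebesgue" "g \<in> borel_measurable lebesgue" "AE x in lebesgue. f x = g x"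
  shows "L2_norm f = L2_norm g"
  unfolding L2_norm_def
  by (rule arg_cong[where f=sqrt], rule integral_cong_AE)
    (use assms in \<open>auto elim!: eventually_mono\<close>)

lemma L2_inner_commute: "L2_inner f g = L2_inner g f"
  by (simp add: L2_inner_def inner_commute)

lemma L2_inner_add_left:
  assumes "f \<in> L2_space" "g \<in> L2_space" "h \<in> L2_space"
  shows "L2_inner (\<lambda>x. f x + g x) h = L2_inner f h + L2_inner g h"
  unfolding L2_inner_def using assms
  by (simp add: inner_simps integrable_L2_inner)

lemma L2_inner_diff_left:
  assumes "f \<in> L2_space" "g \<in> L2_space" "h \<in> L2_space"
  shows "L2_inner (\<lambda>x. f x - g x) h = L2_inner f h - L2_inner g h"
  unfolding L2_inner_def using assms
  by (simp add: inner_simps integrable_L2_inner)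

lemma L2_inner_scaleR_left: "L2_inner (\<lambda>x. c *\<^sub>R f x) h = c * L2_inner f h"
  unfolding L2_inner_def by simp

lemma L2_norm_add_scaleR_power2:
  assumes f: "f \<in> L2_space" and g: "g \<in> L2_space"
  shows "(L2_norm (\<lambda>x. f x + c *\<^sub>R g x))\<^sup>2 = (L2_norm f)\<^sup>2 + 2 * c * L2_inner f g + c\<^sup>2 * (L2_norm g)\<^sup>2"
proof -
  note cg = L2_space_scaleR[OF g, of c]
  have "L2_inner (\<lambda>x. f x + c *\<^sub>R g x) (\<lambda>x. f x + c *\<^sub>R g x)
    = L2_inner f (\<lambda>x. f x + c *\<^sub>R g x) + c * L2_inner g (\<lambda>x. f x + c *\<^sub>R g x)"
    by (simp add: L2_inner_add_left f cg L2_space_add L2_inner_scaleR_left)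
  also have "\<dots> = L2_inner f f + c * L2_inner g f + c * (L2_inner f g + c * L2_inner g g)"
    using f g cg
    by (simp add: L2_inner_commute[of f "\<lambda>x. f x + c *\<^sub>R g x"] L2_inner_commute[of g "\<lambda>x. f x + c *\<^sub>R g x"]
        L2_inner_add_left L2_inner_scaleR_left)
  finally show ?thesis
    unfolding L2_norm_power2 by (simp add: L2_inner_commute[of g f] power2_eq_square algebra_simps)
qed

lemma L2_norm_scaleR: "L2_norm (\<lambda>x. c *\<^sub>R f x) = \<bar>c\<bar> * L2_norm f"
  unfolding L2_norm_def by (simp add: power_mult_distrib real_sqrt_mult)

lemma L2_norm_diff_power2:
  assumes f: "f \<in> L2_space" and g: "g \<in> L2_space"
  shows "(L2_norm (\<lambda>x. f x - g x))\<^sup>2 = (L2_norm f)\<^sup>2 - 2 * L2_inner f g + (L2_norm g)\<^sup>2"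
  using L2_norm_add_scaleR_power2[OF f g, of "-1"] by simp

lemma L2_Cauchy_Schwarz:
  assumes f: "f \<in> L2_space" and g: "g \<in> L2_space"
  shows "\<bar>L2_inner f g\<bar> \<le> L2_norm f * L2_norm g"
proof -
  define a b c where "a = (L2_norm f)\<^sup>2" and "b = L2_inner f g" and "c = (L2_norm g)\<^sup>2"
  have q: "0 \<le> a + 2 * t * b + t\<^sup>2 * c" for t
    using L2_norm_add_scaleR_power2[OF f g, of t] unfolding a_def b_def c_def
    by (metis zero_le_power2)
  have "b\<^sup>2 \<le> a * c"
  proof (cases "c = 0")
    case True
    have "b = 0"
    proof (rule ccontr)
      \<comment> \<open>for vanishing leading coefficient the quadratic is affine in \<open>t\<close>, so it takes the value \<open>- 1\<close>\<close>
      assume "b \<noteq> 0"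
      then show False using q[of "- (a + 1) / (2 * b)"] True by (simp add: field_simps)
    qed
    then show ?thesis by (simp add: True)
  next
    case False
    then have "c > 0" by (simp add: c_def)
    then show ?thesis using q[of "- b / c"] by (simp add: field_simps power2_eq_square)
  qed
  then have "\<bar>b\<bar> \<le> sqrt (a * c)"
    by (metis real_sqrt_abs real_sqrt_le_iff)
  then show ?thesis
    by (simp add: a_def b_def c_def real_sqrt_mult L2_norm_nonneg)
qed

lemma L2_norm_triangle:
  assumes f: "f \<in> L2_space" and g: "g \<in> L2_space"
  shows "L2_norm (\<lambda>x. f x + g x) \<le> L2_norm f + L2_norm g"
proof (rule power2_le_imp_le)
  show "(L2_norm (\<lambda>x. f x + g x))\<^sup>2 \<le> (L2_norm f + L2_norm g)\<^sup>2"
    using L2_norm_add_scaleR_power2[OF f g, of 1] L2_Cauchy_Schwarz[OF f g]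
    by (simp add: power2_sum abs_le_iff)
qed (simp add: L2_norm_nonneg)

lemma L2_norm_diff_commute: "L2_norm (\<lambda>x. f x - g x) = L2_norm (\<lambda>x. g x - f x)"
  unfolding L2_norm_def by (simp add: norm_minus_commute)

lemma L2_norm_triangle_diff:
  assumes f: "f \<in> L2_space" and g: "g \<in> L2_space" and h: "h \<in> L2_space"
  shows "L2_norm (\<lambda>x. f x - h x) \<le> L2_norm (\<lambda>x. f x - g x) + L2_norm (\<lambda>x. g x - h x)"
  using L2_norm_triangle[OF L2_space_diff[OF f g] L2_space_diff[OF g h]] by simp

lemma L2_norm_triangle_rev:
  assumes f: "f \<in> L2_space" and g: "g \<in> L2_space"
  shows "\<bar>L2_norm f - L2_norm g\<bar> \<le> L2_norm (\<lambda>x. f x - g x)"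
  using L2_norm_triangle_diff[OF f g L2_space_zero] L2_norm_triangle_diff[OF g f L2_space_zero]
  by (simp add: L2_norm_diff_commute[of g f])

lemma L2_norm_tendsto:
  assumes f: "f \<in> L2_space" and g: "\<And>k. g k \<in> L2_space"
    and lim: "(\<lambda>k. L2_norm (\<lambda>x. g k x - f x)) \<longlonglongrightarrow> 0"
  shows "(\<lambda>k. L2_norm (g k)) \<longlonglongrightarrow> L2_norm f"
  by (rule LIM_zero_cancel, rule Lim_null_comparison[OF _ lim])
    (use L2_norm_triangle_rev[OF g f] in simp)

lemma L2_inner_tendsto:
  assumes f: "f \<in> L2_space" and g: "\<And>k. g k \<in> L2_space" and h: "h \<in> L2_space"
    and lim: "(\<lambda>k. L2_norm (\<lambda>x. g k x - f x)) \<longlonglongrightarrow> 0"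
  shows "(\<lambda>k. L2_inner (g k) h) \<longlonglongrightarrow> L2_inner f h"
proof (rule LIM_zero_cancel, rule Lim_null_comparison)
  show "(\<lambda>k. L2_norm (\<lambda>x. g k x - f x) * L2_norm h) \<longlonglongrightarrow> 0"
    using tendsto_mult_right[OF lim, of "L2_norm h"] by simp
  show "\<forall>\<^sub>F k in sequentially. norm (L2_inner (g k) h - L2_inner f h) \<le> L2_norm (\<lambda>x. g k x - f x) * L2_norm h"
    using L2_Cauchy_Schwarz[OF L2_space_diff[OF g f] h]
    by (simp add: L2_inner_diff_left g f h)
qed

lemma L2_norm_eq_0_iff_AE:
  assumes "f \<in> L2_space"
  shows "L2_norm f = 0 \<longleftrightarrow> (AE x in lebesgue. f x = 0)"
  using assms unfolding L2_norm_def L2_space_def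
  by (subst real_sqrt_eq_0_iff, subst integral_nonneg_eq_0_iff_AE) auto

text \<open>
  The weights \<open>4\<^sup>k\<close> are small enough for the weighted squared increments to have a finite
  integral, hence a finite sum almost everywhere, and large enough for finiteness of that sum to
  force geometric decay of the increments.
\<close>

lemma L2_complete_subseq:
  fixes f :: "nat \<Rightarrow> 'a::euclidean_space \<Rightarrow> 'b::euclidean_space"
  assumes f: "\<And>k. f k \<in> L2_space"
    and fast: "\<And>k. (L2_norm (\<lambda>x. f (Suc k) x - f k x))\<^sup>2 \<le> (1/8) ^ k"
  shows "AE x in lebesgue. convergent (\<lambda>k. f k x)"
proof -
  note [measurable] = L2_space_measurable[OF f]
  define a where "a k x = norm (f (Suc k) x - f k x)" for k x
  have [measurable]: "a k \<in> borel_measurable lebesgue" for k unfolding a_def by measurable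
  have "(\<integral>\<^sup>+x. (\<Sum>k. ennreal (4 ^ k * (a k x)\<^sup>2)) \<partial>lebesgue) = (\<Sum>k. \<integral>\<^sup>+x. ennreal (4 ^ k * (a k x)\<^sup>2) \<partial>lebesgue)"
    by (rule nn_integral_suminf) measurable
  also have "\<dots> \<le> (\<Sum>k. ennreal ((1/2) ^ k))"
  proof (rule suminf_le)
    fix k
    have "(\<integral>\<^sup>+x. ennreal (4 ^ k * (a k x)\<^sup>2) \<partial>lebesgue) = ennreal (4 ^ k) * (\<integral>\<^sup>+x. ennreal ((a k x)\<^sup>2) \<partial>lebesgue)"
      by (simp add: ennreal_mult nn_integral_cmult)
    also have "(\<integral>\<^sup>+x. ennreal ((a k x)\<^sup>2) \<partial>lebesgue) = ennreal ((L2_norm (\<lambda>x. f (Suc k) x - f k x))\<^sup>2)"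
      unfolding a_def by (rule nn_integral_eq_L2_norm[OF L2_space_diff[OF f f]])
    also have "ennreal (4 ^ k) * \<dots> \<le> ennreal (4 ^ k) * ennreal ((1/8) ^ k)"
      by (intro mult_left_mono ennreal_leI fast) auto
    also have "\<dots> = ennreal ((1/2) ^ k)"
    proof -
      have "(4::real) ^ k * (1/8) ^ k = (4 * (1/8)) ^ k" by (simp only: power_mult_distrib)
      then show ?thesis by (simp flip: ennreal_mult)
    qed
    finally show "(\<integral>\<^sup>+x. ennreal (4 ^ k * (a k x)\<^sup>2) \<partial>lebesgue) \<le> ennreal ((1/2) ^ k)" .
  qed auto
  also have "\<dots> < \<infinity>"
    by (subst suminf_ennreal2) auto
  finally have "AE x in lebesgue. (\<Sum>k. ennreal (4 ^ k * (a k x)\<^sup>2)) \<noteq> \<infinity>"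
    by (intro nn_integral_noteq_infinite) auto
  then show ?thesis
  proof eventually_elim
    fix x assume fin: "(\<Sum>k. ennreal (4 ^ k * (a k x)\<^sup>2)) \<noteq> \<infinity>"
    have "\<exists>C\<ge>0. y = ennreal C" if "y \<noteq> \<infinity>" for y :: ennreal
      using that by (cases y) auto
    from this[OF fin] obtain C where C: "(\<Sum>k. ennreal (4 ^ k * (a k x)\<^sup>2)) = ennreal C" "C \<ge> 0"
      by blast
    have bound: "norm (f (Suc k) x - f k x) \<le> sqrt C * (1/2) ^ k" for k
    proof -
      have term_le: "ennreal (b k) \<le> (\<Sum>k. ennreal (b k))" for b :: "nat \<Rightarrow> real"
        using sum_le_suminf[of "\<lambda>k. ennreal (b k)" "{k}"] by simp
      have "ennreal (4 ^ k * (a k x)\<^sup>2) \<le> ennreal C"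
        using term_le[of "\<lambda>k. 4 ^ k * (a k x)\<^sup>2"] unfolding C .
      then have "4 ^ k * (a k x)\<^sup>2 \<le> C" using C(2) by (simp only: ennreal_le_iff)
      moreover have "((2::real) ^ k)\<^sup>2 = 4 ^ k"
        using power_mult_distrib[of "2::real" 2 k] by (simp add: power2_eq_square)
      ultimately have "(2 ^ k * a k x)\<^sup>2 \<le> C"
        by (simp only: power_mult_distrib)
      then have "2 ^ k * a k x \<le> sqrt C"
        by (rule real_le_rsqrt)
      then show ?thesis by (simp add: a_def field_simps power_divide)
    qed
    have "summable (\<lambda>k. f (Suc k) x - f k x)"
    proof (rule summable_comparison_test'[OF _ bound])
      show "summable (\<lambda>k. sqrt C * (1/2) ^ k)"
        by (rule summable_mult, rule summable_geometric) simp
    qed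
    then have "convergent (\<lambda>n. \<Sum>k<n. f (Suc k) x - f k x)"
      by (simp add: summable_iff_convergent)
    then have "convergent (\<lambda>n. f n x - f 0 x)"
      by (subst (asm) sum_lessThan_telescope[where f="\<lambda>k. f k x"])
    then show "convergent (\<lambda>k. f k x)"
      unfolding convergent_diff_const_right_iff .
  qed
qed

text \<open>
  Riesz-Fischer: along a rapidly Cauchy subsequence the functions converge almost everywhere, and
  Fatou's lemma turns pointwise convergence back into convergence in norm.
\<close>

lemma L2_complete:
  fixes f :: "nat \<Rightarrow> 'a::euclidean_space \<Rightarrow> 'b::euclidean_space"
  assumes f: "\<And>k. f k \<in> L2_space"
    and cauchy: "\<And>e. e > 0 \<Longrightarrow> \<exists>N. \<forall>m\<ge>N. \<forall>n\<ge>N. L2_norm (\<lambda>x. f m x - f n x) < e"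
  obtains g where "g \<in> L2_space" "(\<lambda>k. L2_norm (\<lambda>x. f k x - g x)) \<longlonglongrightarrow> 0"
proof -
  note [measurable] = L2_space_measurable[OF f]
  have "\<exists>N. \<forall>m\<ge>N. \<forall>n\<ge>N. L2_norm (\<lambda>x. f m x - f n x) < sqrt ((1/8) ^ k)" for k
    by (rule cauchy) simp
  then obtain N where N: "\<And>k m n. m \<ge> N k \<Longrightarrow> n \<ge> N k \<Longrightarrow> L2_norm (\<lambda>x. f m x - f n x) < sqrt ((1/8) ^ k)"
    by metis
  \<comment> \<open>a strictly increasing choice of indices beyond the \<open>N k\<close>\<close>
  define r where "r = rec_nat (N 0) (\<lambda>k m. max (Suc m) (N (Suc k)))"
  have rN: "r k \<ge> N k" for k by (cases k) (auto simp: r_def)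
  have rs: "r k < r (Suc k)" for k by (auto simp: r_def)
  have r: "strict_mono r" using rs by (simp add: strict_mono_Suc_iff)
  have "AE x in lebesgue. convergent (\<lambda>k. f (r k) x)"
  proof (rule L2_complete_subseq)
    fix k
    have "L2_norm (\<lambda>x. f (r (Suc k)) x - f (r k) x) \<le> sqrt ((1/8) ^ k)"
      using N[of k "r (Suc k)" "r k"] rN[of k] rs[of k] by simp
    then have "(L2_norm (\<lambda>x. f (r (Suc k)) x - f (r k) x))\<^sup>2 \<le> (sqrt ((1/8) ^ k))\<^sup>2"
      by (intro power_mono L2_norm_nonneg)
    then show "(L2_norm (\<lambda>x. f (r (Suc k)) x - f (r k) x))\<^sup>2 \<le> (1/8) ^ k" by simp
  qed (rule f)
  define g where "g x = lim (\<lambda>k. f (r k) x)" for x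
  have [measurable]: "g \<in> borel_measurable lebesgue"
    unfolding g_def by (rule borel_measurable_lim_metric) simp
  have lim: "AE x in lebesgue. (\<lambda>k. f (r k) x) \<longlonglongrightarrow> g x"
    using \<open>AE x in lebesgue. convergent (\<lambda>k. f (r k) x)\<close> unfolding g_def
    by eventually_elim (simp add: convergent_LIMSEQ_iff)
  have close: "\<exists>N. \<forall>n\<ge>N. (\<integral>\<^sup>+x. ennreal ((norm (f n x - g x))\<^sup>2) \<partial>lebesgue) \<le> ennreal (e\<^sup>2)" if "e > 0" for e
  proof -
    obtain M where M: "\<And>m n. m \<ge> M \<Longrightarrow> n \<ge> M \<Longrightarrow> L2_norm (\<lambda>x. f m x - f n x) < e"
      using cauchy[OF \<open>e > 0\<close>] by blast
    have "(\<integral>\<^sup>+x. ennreal ((norm (f n x - g x))\<^sup>2) \<partial>lebesgue) \<le> ennreal (e\<^sup>2)" if "n \<ge> M" for n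
    proof -
      have "(\<integral>\<^sup>+x. ennreal ((norm (f n x - g x))\<^sup>2) \<partial>lebesgue)
        = (\<integral>\<^sup>+x. liminf (\<lambda>k. ennreal ((norm (f n x - f (r k) x))\<^sup>2)) \<partial>lebesgue)"
      proof (rule nn_integral_cong_AE, use lim in eventually_elim)
        fix x assume "(\<lambda>k. f (r k) x) \<longlonglongrightarrow> g x"
        then have "(\<lambda>k. ennreal ((norm (f n x - f (r k) x))\<^sup>2)) \<longlonglongrightarrow> ennreal ((norm (f n x - g x))\<^sup>2)"
          by (intro tendsto_intros)
        then show "ennreal ((norm (f n x - g x))\<^sup>2) = liminf (\<lambda>k. ennreal ((norm (f n x - f (r k) x))\<^sup>2))"
          by (metis lim_imp_Liminf sequentially_bot)
      qed
      also have "\<dots> \<le> liminf (\<lambda>k. \<integral>\<^sup>+x. ennreal ((norm (f n x - f (r k) x))\<^sup>2) \<partial>lebesgue)"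
        by (rule nn_integral_liminf) measurable
      also have "\<dots> \<le> limsup (\<lambda>k. \<integral>\<^sup>+x. ennreal ((norm (f n x - f (r k) x))\<^sup>2) \<partial>lebesgue)"
        by (rule Liminf_le_Limsup) simp
      also have "\<dots> \<le> ennreal (e\<^sup>2)"
      proof (rule Limsup_bounded)
        show "\<forall>\<^sub>F k in sequentially. (\<integral>\<^sup>+x. ennreal ((norm (f n x - f (r k) x))\<^sup>2) \<partial>lebesgue) \<le> ennreal (e\<^sup>2)"
          using eventually_ge_at_top[of M]
        proof eventually_elim
          fix k assume "k \<ge> M"
          then have "r k \<ge> M" using strict_mono_imp_increasing[OF r, of k] by simp
          then have "L2_norm (\<lambda>x. f n x - f (r k) x) \<le> e" using M[OF \<open>n \<ge> M\<close>] by fastforce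
          then show "(\<integral>\<^sup>+x. ennreal ((norm (f n x - f (r k) x))\<^sup>2) \<partial>lebesgue) \<le> ennreal (e\<^sup>2)"
            by (subst nn_integral_eq_L2_norm[OF L2_space_diff[OF f f]])
              (intro ennreal_leI power_mono L2_norm_nonneg)
        qed
      qed
      finally show ?thesis .
    qed
    then show ?thesis by blast
  qed
  have diff: "\<exists>N. \<forall>n\<ge>N. (\<lambda>x. f n x - g x) \<in> L2_space"
    using close[of 1] by (fastforce simp: L2_space_iff_nn_integral intro: le_less_trans[of _ 1])
  have g: "g \<in> L2_space"
  proof -
    obtain n where "(\<lambda>x. f n x - g x) \<in> L2_space" using diff by blast
    from L2_space_diff[OF f this, of n] show ?thesis by simp
  qed
  have "(\<lambda>k. L2_norm (\<lambda>x. f k x - g x)) \<longlonglongrightarrow> 0"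
  proof (rule LIMSEQ_I)
    fix e :: real assume "e > 0"
    then obtain M where M: "\<And>n. n \<ge> M \<Longrightarrow> (\<integral>\<^sup>+x. ennreal ((norm (f n x - g x))\<^sup>2) \<partial>lebesgue) \<le> ennreal ((e/2)\<^sup>2)"
      using close[of "e/2"] by auto
    have "L2_norm (\<lambda>x. f n x - g x) \<le> e / 2" if "n \<ge> M" for n
    proof (rule power2_le_imp_le)
      have "ennreal ((L2_norm (\<lambda>x. f n x - g x))\<^sup>2) \<le> ennreal ((e/2)\<^sup>2)"
        using M[OF that] by (simp add: nn_integral_eq_L2_norm[OF L2_space_diff[OF f g]])
      then show "(L2_norm (\<lambda>x. f n x - g x))\<^sup>2 \<le> (e/2)\<^sup>2"
        by (subst (asm) ennreal_le_iff) auto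
    qed (use \<open>e > 0\<close> in simp)
    then show "\<exists>M. \<forall>n\<ge>M. norm (L2_norm (\<lambda>x. f n x - g x) - 0) < e"
      using \<open>e > 0\<close> by (intro exI[of _ M]) (fastforce simp: L2_norm_nonneg)
  qed
  with g show thesis by (rule that)
qed

lemma L2_space_norm:
  assumes "f \<in> L2_space" shows "(\<lambda>x. norm (f x)) \<in> L2_space"
  using assms by (auto simp: L2_space_def)

lemma L2_dominated_convergence:
  fixes f :: "'a::euclidean_space \<Rightarrow> 'b::euclidean_space"
  assumes f [measurable]: "f \<in> borel_measurable lebesgue"
    and u [measurable]: "\<And>k. u k \<in> borel_measurable lebesgue"
    and w: "w \<in> L2_space"
    and bound: "\<And>k. AE x in lebesgue. norm (u k x) \<le> w x"
    and lim: "AE x in lebesgue. (\<lambda>k. u k x) \<longlonglongrightarrow> f x"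
  shows "(\<lambda>k. L2_norm (\<lambda>x. u k x - f x)) \<longlonglongrightarrow> 0"
proof -
  have bound_all: "AE x in lebesgue. \<forall>k. norm (u k x) \<le> w x"
    using bound by (simp add: AE_all_countable)
  have "(\<lambda>k. LINT x|lebesgue. (norm (u k x - f x))\<^sup>2) \<longlonglongrightarrow> (LINT x|(lebesgue :: 'a measure). 0)"
  proof (rule integral_dominated_convergence)
    show "integrable lebesgue (\<lambda>x. (norm (2 *\<^sub>R w x))\<^sup>2)"
      using L2_space_scaleR[OF w, of 2] by (simp add: L2_space_def)
    show "AE x in lebesgue. (\<lambda>k. (norm (u k x - f x))\<^sup>2) \<longlonglongrightarrow> 0"
      using lim
    proof eventually_elim
      fix x assume "(\<lambda>k. u k x) \<longlonglongrightarrow> f x"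
      then have "(\<lambda>k. (norm (u k x - f x))\<^sup>2) \<longlonglongrightarrow> (norm (f x - f x))\<^sup>2"
        by (intro tendsto_intros)
      then show "(\<lambda>k. (norm (u k x - f x))\<^sup>2) \<longlonglongrightarrow> 0" by simp
    qed
    show "AE x in lebesgue. norm ((norm (u k x - f x))\<^sup>2) \<le> (norm (2 *\<^sub>R w x))\<^sup>2" for k
      using lim bound_all
    proof eventually_elim
      fix x assume lim: "(\<lambda>k. u k x) \<longlonglongrightarrow> f x" and b: "\<forall>k. norm (u k x) \<le> w x"
      have "norm (f x) \<le> w x"
        by (rule Lim_bounded[OF tendsto_norm[OF lim], of 0]) (use b in simp)
      then have "norm (u k x - f x) \<le> norm (2 *\<^sub>R w x)"
        using norm_triangle_ineq4[of "u k x" "f x"] b[rule_format, of k] by simp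
      then show "norm ((norm (u k x - f x))\<^sup>2) \<le> (norm (2 *\<^sub>R w x))\<^sup>2"
        using power_mono[OF _ norm_ge_zero, of _ _ 2] by fastforce
    qed
  qed auto
  then have "(\<lambda>k. sqrt (LINT x|lebesgue. (norm (u k x - f x))\<^sup>2)) \<longlonglongrightarrow> sqrt 0"
    by (intro tendsto_real_sqrt) simp
  then show ?thesis by (simp add: L2_norm_def)
qed

lemma L2_truncation_tendsto:
  assumes f: "f \<in> L2_space"
  shows "(\<lambda>k. L2_norm (\<lambda>x. indicator (ball 0 (real k)) x *\<^sub>R f x - f x)) \<longlonglongrightarrow> 0"
proof (rule L2_dominated_convergence)
  show "f \<in> borel_measurable lebesgue" by (rule L2_space_measurable[OF f])
  show "(\<lambda>x. indicator (ball 0 (real k)) x *\<^sub>R f x) \<in> borel_measurable lebesgue" for k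
    by (rule L2_space_measurable[OF L2_space_indicator[OF f]]) simp
  show "(\<lambda>x. norm (f x)) \<in> L2_space"
    by (rule L2_space_norm[OF f])
  show "AE x in lebesgue. norm (indicator (ball 0 (real k)) x *\<^sub>R f x) \<le> norm (f x)" for k
    by (rule AE_I2) (simp add: indicator_def)
  have "(\<lambda>k. indicator (ball 0 (real k)) x *\<^sub>R f x) \<longlonglongrightarrow> f x" for x
  proof (rule tendsto_eventually)
    obtain N :: nat where N: "norm x < real N" using reals_Archimedean2 by blast
    show "\<forall>\<^sub>F k in sequentially. indicator (ball 0 (real k)) x *\<^sub>R f x = f x"
      using eventually_ge_at_top[of N] by eventually_elim (use N in \<open>simp add: indicator_def\<close>)
  qed
  then show "AE x in lebesgue. (\<lambda>k. indicator (ball 0 (real k)) x *\<^sub>R f x) \<longlonglongrightarrow> f x"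
    by simp
qed

lemma L2_space_indicator_const:
  assumes "A \<in> lmeasurable"
  shows "(\<lambda>x. indicator A x *\<^sub>R c) \<in> L2_space"
proof -
  have "(\<lambda>x. (norm (indicator A x *\<^sub>R c))\<^sup>2) = (\<lambda>x. indicator A x *\<^sub>R (norm c)\<^sup>2)"
    by (auto simp: fun_eq_iff indicator_def)
  then show ?thesis
    using assms by (auto simp: L2_space_def fmeasurable_def)
qed

text \<open>
  A measurable function is an almost everywhere limit of continuous functions. Clipping the values
  and cutting off the support supply the dominating functions that turn this, by two passages to the
  limit, into approximation in \<open>L\<^sup>2\<close>.
\<close>

lemma L2_dense_bounded_continuous:
  fixes f :: "'a::euclidean_space \<Rightarrow> 'b::euclidean_space"
  assumes f: "f \<in> L2_space" and e: "0 < e"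
  obtains g K where "continuous_on UNIV g" "\<And>x. norm (g x) \<le> K" "g \<in> L2_space"
    "L2_norm (\<lambda>x. f x - g x) < e"
proof -
  note fm = L2_space_measurable[OF f]
  have "f measurable_on UNIV"
    by (rule lebesgue_measurable_imp_measurable_on[OF fm]) simp
  then obtain N G where N: "negligible N" and G: "\<And>n::nat. continuous_on UNIV (G n)"
    and Glim: "\<And>x. x \<notin> N \<Longrightarrow> (\<lambda>n. G n x) \<longlonglongrightarrow> f x"
    by (auto simp: measurable_on_def)
  define clip where "clip k y = (real (Suc k) / max (real (Suc k)) (norm y)) *\<^sub>R y" for k and y :: 'b
  define cutoff where "cutoff k x = max 0 (min 1 (real (Suc k) - norm x))" for k and x :: 'a
  have clip_norm: "norm (clip k y) \<le> norm y" "norm (clip k y) \<le> real (Suc k)" for k y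
    by (auto simp: clip_def field_simps max_def simp del: of_nat_Suc intro: mult_right_mono)
  have cutoff: "0 \<le> cutoff k x" "cutoff k x \<le> 1" "norm x \<ge> real (Suc k) \<Longrightarrow> cutoff k x = 0" for k x
    by (auto simp: cutoff_def)
  have clip_cont: "continuous_on UNIV (clip k)" for k
    unfolding clip_def by (intro continuous_intros) (auto simp: max_def)
  have cutoff_cont: "continuous_on UNIV (cutoff k)" for k
    unfolding cutoff_def by (intro continuous_intros)
  have clip_meas: "clip k \<in> borel_measurable borel" for k
    by (rule borel_measurable_continuous_onI[OF clip_cont])
  have cutoff_meas: "cutoff k \<in> borel_measurable lebesgue" for k
    using borel_measurable_continuous_onI[OF cutoff_cont] by (simp add: measurable_completion)
  have meas: "(\<lambda>x. cutoff k x *\<^sub>R clip k (v x)) \<in> borel_measurable lebesgue"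
    if "v \<in> borel_measurable lebesgue" for k v
    by (intro borel_measurable_scaleR cutoff_meas measurable_compose[OF that clip_meas])
  have norm_le: "norm (cutoff k x *\<^sub>R clip k y) \<le> norm (clip k y)" for k x y
    using cutoff[of k x] by (simp add: mult_left_le_one_le)
  have "(\<lambda>k. L2_norm (\<lambda>x. cutoff k x *\<^sub>R clip k (f x) - f x)) \<longlonglongrightarrow> 0"
  proof (rule L2_dominated_convergence[OF fm meas[OF fm]])
    show "(\<lambda>x. norm (f x)) \<in> L2_space"
      by (rule L2_space_norm[OF f])
    show "AE x in lebesgue. norm (cutoff k x *\<^sub>R clip k (f x)) \<le> norm (f x)" for k
      using order_trans[OF norm_le clip_norm(1)] by (intro AE_I2)
    have "(\<lambda>k. cutoff k x *\<^sub>R clip k (f x)) \<longlonglongrightarrow> f x" for x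
    proof (rule tendsto_eventually)
      obtain M :: nat where M: "max (norm x + 1) (norm (f x)) < real M" using reals_Archimedean2 by blast
      show "\<forall>\<^sub>F k in sequentially. cutoff k x *\<^sub>R clip k (f x) = f x"
        using eventually_ge_at_top[of M]
      proof eventually_elim
        fix k assume "k \<ge> M"
        then have "real (Suc k) - norm x \<ge> 1" "norm (f x) \<le> real (Suc k)" using M by auto
        then show "cutoff k x *\<^sub>R clip k (f x) = f x"
          by (simp add: cutoff_def clip_def max_absorb1 min_absorb1 del: of_nat_Suc)
      qed
    qed
    then show "AE x in lebesgue. (\<lambda>k. cutoff k x *\<^sub>R clip k (f x)) \<longlonglongrightarrow> f x" by simp
  qed
  then obtain k where k: "L2_norm (\<lambda>x. cutoff k x *\<^sub>R clip k (f x) - f x) < e / 2"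
    using e by (metis (no_types, lifting) LIMSEQ_D diff_zero half_gt_zero order_refl real_norm_def abs_le_D1 abs_less_iff)
  \<comment> \<open>for fixed \<open>k\<close> all functions \<open>h v\<close> are dominated by the multiple \<open>w\<close> of the indicator of a ball\<close>
  define h where "h v x = cutoff k x *\<^sub>R clip k (v x)" for v :: "'a \<Rightarrow> 'b" and x
  define w where "w x = indicator (cball 0 (real (Suc k))) x *\<^sub>R real (Suc k)" for x :: 'a
  have w: "w \<in> L2_space"
    unfolding w_def by (rule L2_space_indicator_const) simp
  have hw: "norm (h v x) \<le> w x" for v x
    using norm_le[of k x "v x"] clip_norm(2)[of k "v x"] cutoff(3)[of k x]
    by (auto simp: h_def w_def indicator_def simp del: of_nat_Suc)
  have Gm: "G n \<in> borel_measurable lebesgue" for n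
    using borel_measurable_continuous_onI[OF G] by (simp add: measurable_completion)
  have hm: "h v \<in> borel_measurable lebesgue" if "v \<in> borel_measurable lebesgue" for v
    unfolding h_def by (rule meas[OF that])
  have h2: "h v \<in> L2_space" if "v \<in> borel_measurable lebesgue" for v
    by (rule L2_space_bound[OF w hm[OF that]]) (use hw[of v] in \<open>auto intro: order_trans abs_ge_self\<close>)
  have "(\<lambda>n. L2_norm (\<lambda>x. h (G n) x - h f x)) \<longlonglongrightarrow> 0"
  proof (rule L2_dominated_convergence[OF hm[OF fm] hm[OF Gm] w])
    have "AE x in lebesgue. x \<notin> N"
      using N by (intro AE_not_in) (simp add: negligible_iff_null_sets)
    then show "AE x in lebesgue. (\<lambda>n. h (G n) x) \<longlonglongrightarrow> h f x"
    proof eventually_elim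
      fix x assume "x \<notin> N"
      have "isCont (clip k) (f x)" using clip_cont by (simp add: continuous_on_eq_continuous_at)
      then show "(\<lambda>n. h (G n) x) \<longlonglongrightarrow> h f x"
        unfolding h_def by (intro tendsto_scaleR tendsto_const isCont_tendsto_compose[OF _ Glim[OF \<open>x \<notin> N\<close>]])
    qed
  qed (use hw in auto)
  then obtain n where n: "L2_norm (\<lambda>x. h (G n) x - h f x) < e / 2"
    using e by (metis (no_types, lifting) LIMSEQ_D diff_zero half_gt_zero order_refl real_norm_def abs_le_D1 abs_less_iff)
  show thesis
  proof
    show "continuous_on UNIV (h (G n))"
      unfolding h_def
      by (intro continuous_intros cutoff_cont continuous_on_compose2[OF clip_cont G]) auto
    show "norm (h (G n) x) \<le> real (Suc k)" for x
      using norm_le[of k x "G n x"] clip_norm(2)[of k "G n x"] by (simp add: h_def del: of_nat_Suc)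
    show "h (G n) \<in> L2_space" by (rule h2[OF Gm])
    have "L2_norm (\<lambda>x. f x - h (G n) x) \<le> L2_norm (\<lambda>x. f x - h f x) + L2_norm (\<lambda>x. h f x - h (G n) x)"
      by (rule L2_norm_triangle_diff[OF f h2[OF fm] h2[OF Gm]])
    also have "\<dots> < e / 2 + e / 2"
    proof (rule add_strict_mono)
      show "L2_norm (\<lambda>x. f x - h f x) < e / 2"
        using k unfolding L2_norm_diff_commute[of f "h f"] by (simp only: h_def)
      show "L2_norm (\<lambda>x. h f x - h (G n) x) < e / 2"
        using n unfolding L2_norm_diff_commute[of "h f" "h (G n)"] .
    qed
    finally show "L2_norm (\<lambda>x. f x - h (G n) x) < e" by simp
  qed
qed

section \<open>Fourier integrals\<close>

lemma borel_measurable_cis [measurable]: "cis \<in> borel_measurable borel"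
  by (intro borel_measurable_continuous_onI continuous_intros)

lemma fourier_integral_cong_AE:
  assumes f: "f \<in> borel_measurable lebesgue" and g: "g \<in> borel_measurable lebesgue"
    and eq: "AE x in lebesgue. f x = g x"
  shows "fourier_integral f \<xi> = fourier_integral g \<xi>"
proof -
  have [measurable]: "(\<lambda>x. cis (- (x \<bullet> \<xi>))) \<in> borel_measurable lebesgue"
    by (intro measurable_completion) measurable
  show ?thesis
    unfolding fourier_integral_def
    by (intro arg_cong[where f="\<lambda>z. _ *\<^sub>R z"] integral_cong_AE)
      (use f g eq in \<open>auto elim!: eventually_mono\<close>)
qed

abbreviation fourier_const :: "'a::euclidean_space itself \<Rightarrow> real" where
  "fourier_const _ \<equiv> (2 * pi) powr (- real DIM('a) / 2)"

lemma fourier_integral_lborel: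
  fixes f :: "'a::euclidean_space \<Rightarrow> complex"
  assumes [measurable]: "f \<in> borel_measurable borel"
  shows "fourier_integral f \<xi> = fourier_const TYPE('a) *\<^sub>R (LINT x|lborel. cis (- (x \<bullet> \<xi>)) * f x)"
  unfolding fourier_integral_def by (subst integral_completion) auto

lemma integrable_cis_mult:
  fixes f :: "'a \<Rightarrow> complex"
  assumes "integrable M f" "g \<in> borel_measurable M"
  shows "integrable M (\<lambda>x. cis (g x) * f x)"
  by (rule Bochner_Integration.integrable_bound[OF assms(1)])
    (use assms in \<open>auto simp: norm_mult intro!: AE_I2\<close>)

lemma borel_measurable_fourier_integral [measurable]:
  fixes f :: "'a::euclidean_space \<Rightarrow> complex"
  assumes [measurable]: "f \<in> borel_measurable borel"
  shows "fourier_integral f \<in> borel_measurable borel"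
  unfolding fourier_integral_lborel[OF assms, abs_def] by measurable

lemma norm_fourier_integral_le:
  fixes f :: "'a::euclidean_space \<Rightarrow> complex"
  assumes [measurable]: "f \<in> borel_measurable borel"
  shows "norm (fourier_integral f \<xi>) \<le> fourier_const TYPE('a) * (LINT x|lborel. norm (f x))"
proof -
  have "norm (LINT x|lborel. cis (- (x \<bullet> \<xi>)) * f x) \<le> (LINT x|lborel. norm (cis (- (x \<bullet> \<xi>)) * f x))"
    by (rule integral_norm_bound)
  then show ?thesis
    by (simp add: fourier_integral_lborel norm_mult mult_left_mono)
qed

lemma lborel_integral_affine:
  fixes f :: "'a::euclidean_space \<Rightarrow> 'b::{banach, second_countable_topology}"
  assumes [measurable]: "f \<in> borel_measurable borel" and c: "c \<noteq> 0"
  shows "(LINT x|lborel. f x) = \<bar>c\<bar> ^ DIM('a) *\<^sub>R (LINT x|lborel. f (t + c *\<^sub>R x))"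
  by (subst lborel_affine[OF c, of t]) (simp add: integral_density integral_distr)

lemma lborel_integrable_affine:
  fixes f :: "'a::euclidean_space \<Rightarrow> 'b::{banach, second_countable_topology}"
  assumes f: "integrable lborel f" and c: "c \<noteq> 0"
  shows "integrable lborel (\<lambda>x. f (t + c *\<^sub>R x))"
proof -
  have [measurable]: "f \<in> borel_measurable borel" using f by simp
  have "integrable (density (distr lborel borel (\<lambda>x. t + c *\<^sub>R x)) (\<lambda>_. \<bar>c\<bar> ^ DIM('a))) f"
    using f lborel_affine[OF c, of t] by simp
  then have "integrable lborel (\<lambda>x. \<bar>c\<bar> ^ DIM('a) *\<^sub>R f (t + c *\<^sub>R x))"
    by (subst (asm) integrable_density) (auto simp: integrable_distr_eq)
  from integrable_scaleR_right[OF this, of "inverse (\<bar>c\<bar> ^ DIM('a))"] show ?thesis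
    using c by simp
qed

section \<open>The Gaussian\<close>

definition gauss :: "'a::euclidean_space \<Rightarrow> real" where
  "gauss x = exp (- (norm x)\<^sup>2 / 2)"

lemma gauss_pos: "0 < gauss x" and gauss_le_1: "gauss x \<le> 1"
  by (simp_all add: gauss_def)

lemma borel_measurable_gauss [measurable]: "gauss \<in> borel_measurable borel"
  unfolding gauss_def by measurable

lemma fourier_gauss_real:
  fixes a :: real
  shows "integrable lborel (\<lambda>t. cis (- (t * a)) * complex_of_real (exp (- t\<^sup>2 / 2)))"
    and "(LINT t|lborel. cis (- (t * a)) * complex_of_real (exp (- t\<^sup>2 / 2)))
      = complex_of_real (sqrt (2 * pi) * exp (- a\<^sup>2 / 2))"
proof -
  have exp_eq: "exp (- t\<^sup>2 / 2) = sqrt (2 * pi) * std_normal_density t" for t :: real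
    by (simp add: normal_density_def)
  show "integrable lborel (\<lambda>t. cis (- (t * a)) * complex_of_real (exp (- t\<^sup>2 / 2)))"
    unfolding exp_eq by (intro integrable_cis_mult integrable_of_real integrable_mult_right) auto
  have "complex_of_real (exp (- (- a)\<^sup>2 / 2)) = char std_normal_distribution (- a)"
    by (simp add: char_std_normal_distribution)
  also have "\<dots> = (LINT t|lborel. std_normal_density t *\<^sub>R cis (- (t * a)))"
    unfolding char_def
    by (subst integral_density) (auto simp: cis_conv_exp mult.commute)
  finally have "complex_of_real (exp (- a\<^sup>2 / 2)) = (LINT t|lborel. std_normal_density t *\<^sub>R cis (- (t * a)))"
    by simp
  moreover have "(LINT t|lborel. cis (- (t * a)) * complex_of_real (exp (- t\<^sup>2 / 2)))
    = (LINT t|lborel. complex_of_real (sqrt (2 * pi)) * (std_normal_density t *\<^sub>R cis (- (t * a))))"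
    unfolding exp_eq by (simp add: scaleR_conv_of_real mult_ac)
  moreover have "\<dots> = complex_of_real (sqrt (2 * pi)) * (LINT t|lborel. std_normal_density t *\<^sub>R cis (- (t * a)))"
    by (rule integral_mult_right_zero)
  ultimately show "(LINT t|lborel. cis (- (t * a)) * complex_of_real (exp (- t\<^sup>2 / 2)))
      = complex_of_real (sqrt (2 * pi) * exp (- a\<^sup>2 / 2))"
    by (simp only: of_real_mult)
qed

lemma cis_sum: "finite A \<Longrightarrow> cis (\<Sum>b\<in>A. h b) = (\<Prod>b\<in>A. cis (h b))"
  by (induction A rule: finite_induct) (simp_all add: cis_mult[symmetric])

text \<open>
  The Gaussian is a product over the coordinates, so the integral factors into one-dimensional
  ones, which are values of the characteristic function of the standard normal distribution.
\<close>

lemma fourier_gauss_lborel: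
  fixes \<xi> :: "'a::euclidean_space"
  shows "integrable lborel (\<lambda>x. cis (- (x \<bullet> \<xi>)) * complex_of_real (gauss x))" (is ?A)
    and "(LINT x|lborel. cis (- (x \<bullet> \<xi>)) * complex_of_real (gauss x))
      = complex_of_real (sqrt (2 * pi) ^ DIM('a) * gauss \<xi>)" (is ?B)
proof -
  interpret product_sigma_finite "\<lambda>_::'a. lborel :: real measure" ..
  let ?P = "PiM (Basis :: 'a set) (\<lambda>_. lborel :: real measure)"
  let ?g = "\<lambda>b t. cis (- (t * (b \<bullet> \<xi>))) * complex_of_real (exp (- t\<^sup>2 / 2))"
  let ?T = "\<lambda>f. \<Sum>b\<in>(Basis :: 'a set). f b *\<^sub>R b"
  let ?F = "\<lambda>x. cis (- (x \<bullet> \<xi>)) * complex_of_real (gauss x)"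
  have T [measurable]: "?T \<in> measurable ?P borel" by measurable
  have [measurable]: "?F \<in> borel_measurable borel" by measurable
  have prod: "?F (?T f) = (\<Prod>b\<in>Basis. ?g b (f b))" for f
  proof -
    have "(norm (?T f))\<^sup>2 = (\<Sum>b\<in>Basis. (f b)\<^sup>2)"
      unfolding power2_norm_eq_inner by (subst euclidean_inner) (simp add: power2_eq_square)
    moreover have "?T f \<bullet> \<xi> = (\<Sum>b\<in>Basis. f b * (b \<bullet> \<xi>))"
      by (simp add: inner_sum_left)
    moreover have "cis (- (\<Sum>b\<in>Basis. h b)) = (\<Prod>b\<in>Basis. cis (- h b))" for h :: "'a \<Rightarrow> real"
      by (simp only: sum_negf[symmetric] cis_sum[OF finite_Basis])
    moreover have "exp (- (\<Sum>b\<in>Basis. h b) / 2) = (\<Prod>b\<in>Basis. exp (- h b / 2))" for h :: "'a \<Rightarrow> real"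
      by (simp only: sum_negf[symmetric] sum_divide_distrib exp_sum[OF finite_Basis])
    ultimately show ?thesis
      by (simp only: gauss_def prod.distrib of_real_prod)
  qed
  have int: "integrable ?P (\<lambda>f. \<Prod>b\<in>Basis. ?g b (f b))"
    by (rule product_integrable_prod) (simp, rule fourier_gauss_real(1))
  show ?A
    by (subst lborel_eq, subst integrable_distr_eq[OF T]) (simp_all only: prod int, measurable)
  have "(LINT x|lborel. ?F x) = (\<integral>f. (\<Prod>b\<in>Basis. ?g b (f b)) \<partial>?P)"
    by (subst lborel_eq, subst integral_distr[OF T]) (simp_all only: prod, measurable)
  also have "\<dots> = (\<Prod>b\<in>Basis. complex_of_real (sqrt (2 * pi) * exp (- (b \<bullet> \<xi>)\<^sup>2 / 2)))"
    by (subst product_integral_prod) (simp_all only: fourier_gauss_real finite_Basis)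
  also have "\<dots> = complex_of_real (sqrt (2 * pi) ^ DIM('a) * (\<Prod>b\<in>Basis. exp (- (b \<bullet> \<xi>)\<^sup>2 / 2)))"
    by (simp add: prod.distrib)
  also have "(\<Prod>b\<in>Basis. exp (- (b \<bullet> \<xi>)\<^sup>2 / 2)) = gauss \<xi>"
  proof -
    have "(norm \<xi>)\<^sup>2 = (\<Sum>b\<in>Basis. (b \<bullet> \<xi>)\<^sup>2)"
      unfolding power2_norm_eq_inner by (subst euclidean_inner) (simp add: power2_eq_square inner_commute)
    then show ?thesis
      by (simp only: gauss_def sum_negf[symmetric] sum_divide_distrib exp_sum[OF finite_Basis])
  qed
  finally show ?B .
qed

lemma integrable_gauss: "integrable lborel (gauss :: 'a::euclidean_space \<Rightarrow> real)"
  using integrable_norm[OF fourier_gauss_lborel(1)[of "0::'a"]] by (simp add: gauss_def[abs_def])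

lemma integral_gauss: "(LINT x|lborel. gauss (x :: 'a::euclidean_space)) = sqrt (2 * pi) ^ DIM('a)"
proof -
  have "complex_of_real (LINT x|lborel. gauss (x :: 'a)) = complex_of_real (sqrt (2 * pi) ^ DIM('a))"
    using fourier_gauss_lborel(2)[of "0::'a"] by (simp add: gauss_def)
  then show ?thesis by (simp only: of_real_eq_iff)
qed

lemma fourier_const_eq: "fourier_const TYPE('a::euclidean_space) = 1 / sqrt (2 * pi) ^ DIM('a)"
proof -
  have "sqrt (2 * pi) ^ DIM('a) = ((2 * pi) powr (1/2)) powr (real DIM('a))"
    by (simp add: powr_half_sqrt powr_realpow)
  also have "\<dots> = (2 * pi) powr (real DIM('a) / 2)" by (simp add: powr_powr)
  finally show ?thesis by (simp add: powr_minus_divide)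
qed

section \<open>Plancherel's identity for integrable functions\<close>

text \<open>
  Up to the normalising constant, both sides are iterated integrals of \<open>cis (- (x \<bullet> \<xi>)) * f x * g \<xi>\<close>.
\<close>

lemma fourier_multiplication:
  fixes f g :: "'a::euclidean_space \<Rightarrow> complex"
  assumes f: "integrable lborel f" and g: "integrable lborel g"
  shows "(LINT \<xi>|lborel. fourier_integral f \<xi> * g \<xi>) = (LINT x|lborel. f x * fourier_integral g x)"
proof -
  have [measurable]: "f \<in> borel_measurable borel" "g \<in> borel_measurable borel"
    using f g by auto
  let ?k = "\<lambda>x \<xi>. cis (- (x \<bullet> \<xi>)) * f x * g \<xi>"
  have "integrable (lborel \<Otimes>\<^sub>M lborel) (case_prod ?k)"
  proof (rule lborel_pair.Fubini_integrable)
    show "AE x in lborel. integrable lborel (\<lambda>\<xi>. case (x, \<xi>) of (x, \<xi>) \<Rightarrow> ?k x \<xi>)"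
      by (auto intro!: AE_I2 integrable_cis_mult simp: mult.assoc g)
    show "integrable lborel (\<lambda>x. LINT \<xi>|lborel. norm (case (x, \<xi>) of (x, \<xi>) \<Rightarrow> ?k x \<xi>))"
      using f by (simp add: norm_mult)
  qed measurable
  from lborel_pair.Fubini_integral[OF this]
  have eq: "(LINT \<xi>|lborel. LINT x|lborel. ?k x \<xi>) = (LINT x|lborel. LINT \<xi>|lborel. ?k x \<xi>)" .
  have "(LINT \<xi>|lborel. fourier_integral f \<xi> * g \<xi>)
    = (LINT \<xi>|lborel. fourier_const TYPE('a) *\<^sub>R (LINT x|lborel. ?k x \<xi>))"
    by (simp add: fourier_integral_lborel flip: integral_mult_left_zero)
  also have "\<dots> = (LINT x|lborel. fourier_const TYPE('a) *\<^sub>R (LINT \<xi>|lborel. ?k x \<xi>))"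
    using eq by simp
  also have "\<dots> = (LINT x|lborel. f x * fourier_integral g x)"
  proof (rule Bochner_Integration.integral_cong)
    fix x
    have "(LINT \<xi>|lborel. ?k x \<xi>) = f x * (LINT \<xi>|lborel. cis (- (\<xi> \<bullet> x)) * g \<xi>)"
      by (subst integral_mult_right_zero[symmetric]) (simp add: inner_commute mult_ac)
    then show "fourier_const TYPE('a) *\<^sub>R (LINT \<xi>|lborel. ?k x \<xi>) = f x * fourier_integral g x"
      by (simp add: fourier_integral_lborel)
  qed simp
  finally show ?thesis .
qed

lemma fourier_gauss_scaled:
  fixes h :: "'a::euclidean_space"
  assumes e: "0 < e"
  shows "fourier_integral (\<lambda>\<xi>. complex_of_real (gauss (e *\<^sub>R \<xi>))) h
    = complex_of_real (gauss (h /\<^sub>R e) / e ^ DIM('a))"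
proof -
  let ?F = "\<lambda>x. cis (- (x \<bullet> h)) * complex_of_real (gauss (e *\<^sub>R x))"
  have "(LINT x|lborel. ?F x) = \<bar>1 / e\<bar> ^ DIM('a) *\<^sub>R (LINT x|lborel. ?F (0 + (1 / e) *\<^sub>R x))"
    by (rule lborel_integral_affine) (use e in auto)
  also have "\<dots> = (1 / e) ^ DIM('a) *\<^sub>R (LINT x|lborel. cis (- (x \<bullet> (h /\<^sub>R e))) * complex_of_real (gauss x))"
    using e by (simp add: divide_inverse)
  also have "\<dots> = complex_of_real (sqrt (2 * pi) ^ DIM('a) * gauss (h /\<^sub>R e) / e ^ DIM('a))"
    unfolding fourier_gauss_lborel(2) by (simp add: scaleR_conv_of_real power_divide)
  finally show ?thesis
    by (subst fourier_integral_lborel, measurable, unfold fourier_const_eq)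
      (simp add: scaleR_conv_of_real)
qed

lemma L2_space_borel_iff:
  assumes [measurable]: "f \<in> borel_measurable borel"
  shows "f \<in> L2_space \<longleftrightarrow> integrable lborel (\<lambda>x. (norm (f x))\<^sup>2)"
  by (simp add: L2_space_def integrable_completion measurable_completion)

lemma L2_norm_borel:
  assumes [measurable]: "f \<in> borel_measurable borel"
  shows "L2_norm f = sqrt (LINT x|lborel. (norm (f x))\<^sup>2)"
  unfolding L2_norm_def by (subst integral_completion) auto

lemma L2_inner_borel:
  assumes [measurable]: "f \<in> borel_measurable borel" "g \<in> borel_measurable borel"
  shows "L2_inner f g = (LINT x|lborel. f x \<bullet> g x)"
  unfolding L2_inner_def by (subst integral_completion) auto

lemma L2_translate:
  fixes f :: "'a::euclidean_space \<Rightarrow> 'b::euclidean_space"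
  assumes [measurable]: "f \<in> borel_measurable borel" and f: "f \<in> L2_space"
  shows "(\<lambda>x. f (x + h)) \<in> L2_space" "L2_norm (\<lambda>x. f (x + h)) = L2_norm f"
proof -
  have i: "integrable lborel (\<lambda>x. (norm (f x))\<^sup>2)" using f by (simp add: L2_space_borel_iff)
  show "(\<lambda>x. f (x + h)) \<in> L2_space"
    using lborel_integrable_affine[OF i, of 1 h] by (simp add: L2_space_borel_iff add.commute)
  show "L2_norm (\<lambda>x. f (x + h)) = L2_norm f"
    using lborel_integral_affine[of "\<lambda>x. (norm (f x))\<^sup>2" 1 h] by (simp add: L2_norm_borel add.commute)
qed

text \<open>
  If the translated factor is replaced by a bounded continuous \<open>g\<close>, convergence is dominated by a
  multiple of \<open>norm (f x)\<close>; the error of the replacement is controlled by the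
  Cauchy-Schwarz inequality, uniformly in the translation.
\<close>

lemma L2_inner_translate_tendsto:
  fixes f :: "'a::euclidean_space \<Rightarrow> 'b::euclidean_space"
  assumes f [measurable]: "f \<in> borel_measurable borel" and f1: "integrable lborel f" and f2: "f \<in> L2_space"
    and h: "h \<longlonglongrightarrow> 0"
  shows "(\<lambda>k. L2_inner f (\<lambda>x. f (x + h k))) \<longlonglongrightarrow> (L2_norm f)\<^sup>2"
proof (rule LIMSEQ_I)
  fix r :: real assume r: "0 < r"
  \<comment> \<open>the summand \<open>1\<close> covers the case of vanishing norm\<close>
  define d where "d = r / (3 * (L2_norm f + 1))"
  have d: "0 < d" "L2_norm f * d \<le> r / 3"
    using r L2_norm_nonneg[of f] by (auto simp: d_def field_simps add_pos_nonneg)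
  obtain g K where g: "continuous_on UNIV g" "\<And>x. norm (g x) \<le> K" "g \<in> L2_space"
    and fg: "L2_norm (\<lambda>x. f x - g x) < d"
    using L2_dense_bounded_continuous[OF f2 d(1)] by metis
  have [measurable]: "g \<in> borel_measurable borel"
    by (rule borel_measurable_continuous_onI[OF g(1)])
  note fg2 = L2_space_diff[OF f2 g(3)]
  have split: "L2_inner f (\<lambda>x. f (x + t)) = L2_inner f (\<lambda>x. f (x + t) - g (x + t)) + L2_inner f (\<lambda>x. g (x + t))" for t
    using L2_inner_diff_left[OF L2_translate(1)[OF f f2, of t] L2_translate(1)[OF _ g(3), of t] f2]
    by (simp add: L2_inner_commute[of f])
  have small: "\<bar>L2_inner f (\<lambda>x. f (x + t) - g (x + t))\<bar> \<le> r / 3" for t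
  proof -
    have "\<bar>L2_inner f (\<lambda>x. f (x + t) - g (x + t))\<bar> \<le> L2_norm f * L2_norm (\<lambda>x. f (x + t) - g (x + t))"
      using L2_translate(1)[OF _ fg2] by (intro L2_Cauchy_Schwarz f2) simp
    also have "L2_norm (\<lambda>x. f (x + t) - g (x + t)) = L2_norm (\<lambda>x. f x - g x)"
      using L2_translate(2)[OF _ fg2] by simp
    also have "L2_norm f * \<dots> \<le> L2_norm f * d"
      using fg by (intro mult_left_mono L2_norm_nonneg) simp
    finally show ?thesis using d(2) by simp
  qed
  have "(\<lambda>k. L2_inner f (\<lambda>x. g (x + h k))) \<longlonglongrightarrow> L2_inner f g"
    unfolding L2_inner_def
  proof (rule integral_dominated_convergence)
    show "integrable lebesgue (\<lambda>x. norm (f x) * K)"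
      using f1 by (simp add: integrable_completion)
    have "(\<lambda>k. f x \<bullet> g (x + h k)) \<longlonglongrightarrow> f x \<bullet> g x" for x
    proof -
      have "(\<lambda>k. x + h k) \<longlonglongrightarrow> x" using tendsto_add[OF tendsto_const[of x] h] by simp
      with g(1) have "(\<lambda>k. g (x + h k)) \<longlonglongrightarrow> g x"
        by (intro isCont_tendsto_compose[of x g]) (simp_all add: continuous_on_eq_continuous_at)
      then show ?thesis by (intro tendsto_inner tendsto_const)
    qed
    then show "AE x in lebesgue. (\<lambda>k. f x \<bullet> g (x + h k)) \<longlonglongrightarrow> f x \<bullet> g x" by simp
    show "AE x in lebesgue. norm (f x \<bullet> g (x + h k)) \<le> norm (f x) * K" for k
      using order_trans[OF Cauchy_Schwarz_ineq2 mult_left_mono[OF g(2) norm_ge_zero]] by (auto intro!: AE_I2)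
  qed (auto intro!: measurable_completion)
  from LIMSEQ_D[OF this, of "r / 3"] obtain N where
    N: "\<And>k. k \<ge> N \<Longrightarrow> \<bar>L2_inner f (\<lambda>x. g (x + h k)) - L2_inner f g\<bar> < r / 3"
    using r by auto
  have abs_split: "\<bar>a + c - (b + d)\<bar> \<le> \<bar>a\<bar> + \<bar>c - d\<bar> + \<bar>b\<bar>" for a b c d :: real
    by arith
  have "norm (L2_inner f (\<lambda>x. f (x + h k)) - (L2_norm f)\<^sup>2) < r" if "k \<ge> N" for k
  proof -
    have "\<bar>L2_inner f (\<lambda>x. f (x + h k)) - L2_inner f (\<lambda>x. f (x + 0))\<bar> < r / 3 + r / 3 + r / 3"
      unfolding split
      by (rule le_less_trans[OF abs_split add_less_le_mono[OF add_le_less_mono[OF small] small]])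
        (use N[OF that] in simp)
    then show ?thesis by (simp add: L2_norm_power2)
  qed
  then show "\<exists>N. \<forall>k\<ge>N. norm (L2_inner f (\<lambda>x. f (x + h k)) - (L2_norm f)\<^sup>2) < r" by blast
qed

lemma borel_measurable_cnj [measurable]: "cnj \<in> borel_measurable borel"
  by (intro borel_measurable_continuous_onI continuous_intros)

text \<open>
  The convolution of \<open>f\<close> with its conjugate reflection. Its Fourier transform is a multiple of
  \<open>\<bar>fourier_integral f\<bar>\<^sup>2\<close> and its value at \<open>0\<close> is the squared norm of \<open>f\<close>, so that Plancherel's
  identity is Fourier inversion of this one function at the origin.
\<close>

definition autocorrelation :: "('a::euclidean_space \<Rightarrow> complex) \<Rightarrow> 'a \<Rightarrow> complex" where
  "autocorrelation f h = (LINT x|lborel. f x * cnj (f (x - h)))"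

lemma autocorrelation_integrable_pair:
  fixes f :: "'a::euclidean_space \<Rightarrow> complex"
  assumes f: "integrable lborel f"
  shows "integrable (lborel \<Otimes>\<^sub>M lborel) (case_prod (\<lambda>x h. f x * cnj (f (x - h))))"
proof (rule lborel_pair.Fubini_integrable)
  have [measurable]: "f \<in> borel_measurable borel" using f by auto
  have refl: "integrable lborel (\<lambda>h. f (x - h))" for x
    using lborel_integrable_affine[OF f, of "-1" x] by simp
  show "AE x in lborel. integrable lborel (\<lambda>h. case (x, h) of (x, h) \<Rightarrow> f x * cnj (f (x - h)))"
    using refl by (auto intro!: AE_I2)
  have "(LINT h|lborel. norm (f (x - h))) = (LINT h|lborel. norm (f h))" for x
    using lborel_integral_affine[of "\<lambda>x. norm (f x)" "-1" x] by simp
  then show "integrable lborel (\<lambda>x. LINT h|lborel. norm (case (x, h) of (x, h) \<Rightarrow> f x * cnj (f (x - h))))"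
    using f by (simp add: norm_mult)
  show "case_prod (\<lambda>x h. f x * cnj (f (x - h))) \<in> borel_measurable (lborel \<Otimes>\<^sub>M lborel)" by measurable
qed

lemma integrable_autocorrelation:
  assumes f: "integrable lborel f"
  shows "integrable lborel (autocorrelation f)"
  unfolding autocorrelation_def[abs_def]
  by (rule lborel_pair.integrable_snd[OF autocorrelation_integrable_pair[OF f]])

text \<open>
  The substitution of \<open>x - h\<close> for \<open>h\<close> separates the double integral into a product of two conjugate
  integrals.
\<close>

lemma fourier_autocorrelation:
  fixes f :: "'a::euclidean_space \<Rightarrow> complex"
  assumes f: "integrable lborel f"
  shows "complex_of_real ((norm (fourier_integral f \<xi>))\<^sup>2)
    = fourier_const TYPE('a) *\<^sub>R fourier_integral (autocorrelation f) \<xi>"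
proof -
  have [measurable]: "f \<in> borel_measurable borel" using f by auto
  have [measurable]: "autocorrelation f \<in> borel_measurable borel"
    using integrable_autocorrelation[OF f] by auto
  define I where "I = (LINT x|lborel. cis (- (x \<bullet> \<xi>)) * f x)"
  let ?k = "\<lambda>x h. cis (- (h \<bullet> \<xi>)) * (f x * cnj (f (x - h)))"
  have "integrable (lborel \<Otimes>\<^sub>M lborel) (\<lambda>p. cis (- (snd p \<bullet> \<xi>)) * case_prod (\<lambda>x h. f x * cnj (f (x - h))) p)"
    by (intro integrable_cis_mult autocorrelation_integrable_pair f) measurable
  then have "integrable (lborel \<Otimes>\<^sub>M lborel) (case_prod ?k)"
    by (simp add: case_prod_beta')
  from lborel_pair.Fubini_integral[OF this]
  have "(LINT h|lborel. LINT x|lborel. ?k x h) = (LINT x|lborel. LINT h|lborel. ?k x h)" .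
  also have "\<dots> = (LINT x|lborel. cis (- (x \<bullet> \<xi>)) * f x * cnj I)"
  proof (rule Bochner_Integration.integral_cong)
    fix x
    have "(LINT h|lborel. cis (- (h \<bullet> \<xi>)) * cnj (f (x - h)))
      = (LINT h|lborel. cis (- ((x - h) \<bullet> \<xi>)) * cnj (f h))"
      using lborel_integral_affine[of "\<lambda>h. cis (- (h \<bullet> \<xi>)) * cnj (f (x - h))" "-1" x] by simp
    also have "\<dots> = (LINT h|lborel. cis (- (x \<bullet> \<xi>)) * cnj (cis (- (h \<bullet> \<xi>)) * f h))"
      by (rule Bochner_Integration.integral_cong) (simp_all add: cis_cnj cis_mult inner_diff_left flip: mult.assoc)
    also have "\<dots> = cis (- (x \<bullet> \<xi>)) * cnj I"
      unfolding I_def integral_mult_right_zero Bochner_Integration.integral_cnj ..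
    finally have "(LINT h|lborel. f x * (cis (- (h \<bullet> \<xi>)) * cnj (f (x - h)))) = f x * (cis (- (x \<bullet> \<xi>)) * cnj I)"
      by simp
    then show "(LINT h|lborel. ?k x h) = cis (- (x \<bullet> \<xi>)) * f x * cnj I"
      by (simp add: mult_ac)
  qed simp
  also have "\<dots> = I * cnj I" by (simp add: I_def)
  finally have "(LINT h|lborel. cis (- (h \<bullet> \<xi>)) * autocorrelation f h) = I * cnj I"
    by (simp add: autocorrelation_def)
  then have "fourier_integral (autocorrelation f) \<xi> = fourier_const TYPE('a) *\<^sub>R (I * cnj I)"
    by (simp add: fourier_integral_lborel)
  moreover have "fourier_integral f \<xi> = fourier_const TYPE('a) *\<^sub>R I"
    by (simp add: fourier_integral_lborel I_def)
  moreover have "I * cnj I = complex_of_real ((norm I)\<^sup>2)"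
    by (rule complex_norm_square[symmetric])
  ultimately show ?thesis
    by (simp add: power_mult_distrib power2_eq_square scaleR_conv_of_real norm_mult)
qed

text \<open>
  The multiplication formula moves the Gaussian weight, which makes the integral of
  \<open>\<bar>fourier_integral f\<bar>\<^sup>2\<close> converge, onto the autocorrelation, where it becomes an average at
  scale \<open>e\<close>. The real part of the autocorrelation at \<open>h\<close> is the inner product of \<open>f\<close> with its
  translate.
\<close>

lemma integral_gauss_fourier:
  fixes f :: "'a::euclidean_space \<Rightarrow> complex"
  assumes f1: "integrable lborel f" and f2: "f \<in> L2_space" and e: "0 < e"
  shows "integrable lborel (\<lambda>\<xi>. gauss (e *\<^sub>R \<xi>) * (norm (fourier_integral f \<xi>))\<^sup>2)"
    and "(LINT \<xi>|lborel. gauss (e *\<^sub>R \<xi>) * (norm (fourier_integral f \<xi>))\<^sup>2)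
      = fourier_const TYPE('a) * (LINT z|lborel. gauss z * L2_inner f (\<lambda>x. f (x + (- e) *\<^sub>R z)))"
proof -
  have fm [measurable]: "f \<in> borel_measurable borel" using f1 by auto
  let ?A = "autocorrelation f"
  let ?G = "\<lambda>\<xi>. complex_of_real (gauss (e *\<^sub>R \<xi> :: 'a))"
  note A1 = integrable_autocorrelation[OF f1]
  have [measurable]: "?A \<in> borel_measurable borel" using A1 by auto
  have g1: "integrable lborel (\<lambda>\<xi>. gauss (e *\<^sub>R \<xi> :: 'a))"
    using lborel_integrable_affine[OF integrable_gauss, of e 0] e by simp
  then have G1: "integrable lborel ?G" by simp
  show "integrable lborel (\<lambda>\<xi>. gauss (e *\<^sub>R \<xi>) * (norm (fourier_integral f \<xi>))\<^sup>2)"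
  proof (rule Bochner_Integration.integrable_bound)
    let ?B = "(fourier_const TYPE('a) * (LINT x|lborel. norm (f x)))\<^sup>2"
    show "integrable lborel (\<lambda>\<xi>. gauss (e *\<^sub>R \<xi> :: 'a) * ?B)" using g1 by simp
    have "(norm (fourier_integral f \<xi>))\<^sup>2 \<le> ?B" for \<xi>
      by (intro power_mono norm_fourier_integral_le fm) simp
    then show "AE \<xi> in lborel. norm (gauss (e *\<^sub>R \<xi>) * (norm (fourier_integral f \<xi>))\<^sup>2) \<le> norm (gauss (e *\<^sub>R \<xi>) * ?B)"
      using gauss_pos by (intro AE_I2) (simp add: abs_mult mult_left_mono)
  qed measurable
  have Re_A: "Re (?A h) = L2_inner f (\<lambda>x. f (x + - h))" for h
  proof -
    note t2 = L2_translate(1)[OF fm f2, of "- h"]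
    have "integrable lebesgue (\<lambda>x. norm (f x) * norm (f (x - h)))"
      using integrable_L2_inner[OF L2_space_norm[OF f2] L2_space_norm[OF t2]] by simp
    then have "integrable lborel (\<lambda>x. norm (f x) * norm (f (x - h)))"
      by (simp add: integrable_completion)
    then have "integrable lborel (\<lambda>x. f x * cnj (f (x - h)))"
      by (rule Bochner_Integration.integrable_bound) (auto simp: norm_mult)
    from integral_Re[OF this] show ?thesis
      by (simp add: autocorrelation_def L2_inner_borel inner_complex_def)
  qed
  have "complex_of_real (LINT \<xi>|lborel. gauss (e *\<^sub>R \<xi>) * (norm (fourier_integral f \<xi>))\<^sup>2)
    = (LINT \<xi>|lborel. fourier_const TYPE('a) *\<^sub>R (fourier_integral ?A \<xi> * ?G \<xi>))"
    unfolding integral_complex_of_real[symmetric] of_real_mult fourier_autocorrelation[OF f1]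
    by (simp add: mult.commute)
  also have "\<dots> = fourier_const TYPE('a) *\<^sub>R (LINT h|lborel. ?A h * fourier_integral ?G h)"
    by (subst integral_scaleR_right) (simp_all only: fourier_multiplication[OF A1 G1])
  also have "(LINT h|lborel. ?A h * fourier_integral ?G h)
    = e ^ DIM('a) *\<^sub>R (LINT z|lborel. ?A (0 + e *\<^sub>R z) * fourier_integral ?G (0 + e *\<^sub>R z))"
    using lborel_integral_affine[of "\<lambda>h. ?A h * fourier_integral ?G h" e 0] e by simp
  also have "\<dots> = (LINT z|lborel. complex_of_real (gauss z) * ?A (e *\<^sub>R z))"
    unfolding fourier_gauss_scaled[OF e] integral_scaleR_right[symmetric]
    using e by (simp add: scaleR_conv_of_real mult_ac)
  finally have "complex_of_real (LINT \<xi>|lborel. gauss (e *\<^sub>R \<xi>) * (norm (fourier_integral f \<xi>))\<^sup>2)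
    = fourier_const TYPE('a) *\<^sub>R (LINT z|lborel. complex_of_real (gauss z) * ?A (e *\<^sub>R z))" .
  then have "(LINT \<xi>|lborel. gauss (e *\<^sub>R \<xi>) * (norm (fourier_integral f \<xi>))\<^sup>2)
    = fourier_const TYPE('a) * Re (LINT z|lborel. complex_of_real (gauss z) * ?A (e *\<^sub>R z))"
    by (metis Re_complex_of_real scaleR_complex.simps(1))
  also have "Re (LINT z|lborel. complex_of_real (gauss z) * ?A (e *\<^sub>R z))
    = (LINT z|lborel. gauss z * L2_inner f (\<lambda>x. f (x + (- e) *\<^sub>R z)))"
  proof (subst integral_Re[symmetric])
    have "integrable lborel (\<lambda>z. ?A (e *\<^sub>R z))"
      using lborel_integrable_affine[OF A1, of e 0] e by simp
    then show "integrable lborel (\<lambda>z. complex_of_real (gauss z) * ?A (e *\<^sub>R z))"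
      by (rule Bochner_Integration.integrable_bound)
        (auto simp: norm_mult less_imp_le[OF gauss_pos] mult_left_le_one_le gauss_le_1)
  qed (simp add: Re_A)
  finally show "(LINT \<xi>|lborel. gauss (e *\<^sub>R \<xi>) * (norm (fourier_integral f \<xi>))\<^sup>2)
      = fourier_const TYPE('a) * (LINT z|lborel. gauss z * L2_inner f (\<lambda>x. f (x + (- e) *\<^sub>R z)))" .
qed

text \<open>
  Let \<open>e\<close> tend to \<open>0\<close> in the previous identity. The Gaussian weights increase to \<open>1\<close>, which
  gives the norm of the transform by monotone convergence (and its finiteness), while the averages
  of the autocorrelation concentrate at the origin.
\<close>

lemma Plancherel_borel:
  fixes f :: "'a::euclidean_space \<Rightarrow> complex"
  assumes f1: "integrable lborel f" and f2: "f \<in> L2_space"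
  shows "fourier_integral f \<in> L2_space" "L2_norm (fourier_integral f) = L2_norm f"
proof -
  have fm [measurable]: "f \<in> borel_measurable borel" using f1 by auto
  define e where "e k = 1 / real (Suc k)" for k
  have e: "e k > 0" "decseq e" "e \<longlonglongrightarrow> 0" for k
    using LIMSEQ_inverse_real_of_nat
    by (auto simp: e_def[abs_def] decseq_def field_simps inverse_eq_divide)
  let ?I = "\<lambda>k z. L2_inner f (\<lambda>x. f (x + (- e k) *\<^sub>R z))"
  have "(\<lambda>k. LINT z|lborel. gauss z * ?I k z) \<longlonglongrightarrow> (LINT z|lborel. gauss (z::'a) * (L2_norm f)\<^sup>2)"
  proof (rule integral_dominated_convergence)
    show "integrable lborel (\<lambda>z. gauss (z::'a) * (L2_norm f)\<^sup>2)"
      by (intro integrable_mult_left integrable_gauss)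
    have "(\<lambda>k. (- e k) *\<^sub>R z) \<longlonglongrightarrow> 0" for z :: 'a
      using tendsto_scaleR[OF tendsto_minus[OF e(3)] tendsto_const[of z]] by simp
    from L2_inner_translate_tendsto[OF fm f1 f2 this]
    show "AE z in lborel. (\<lambda>k. gauss z * ?I k z) \<longlonglongrightarrow> gauss z * (L2_norm f)\<^sup>2"
      by (intro AE_I2 tendsto_mult tendsto_const)
    have "\<bar>?I k z\<bar> \<le> (L2_norm f)\<^sup>2" for k z
      using L2_Cauchy_Schwarz[OF f2 L2_translate(1)[OF fm f2]] L2_translate(2)[OF fm f2]
      by (metis power2_eq_square)
    then show "AE z in lborel. norm (gauss z * ?I k z) \<le> gauss z * (L2_norm f)\<^sup>2" for k
      by (intro AE_I2) (simp add: abs_mult less_imp_le[OF gauss_pos] abs_of_pos[OF gauss_pos] mult_left_mono)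
    show "(\<lambda>z. gauss z * ?I k z) \<in> borel_measurable lborel" for k
      by (subst L2_inner_borel) measurable
  qed (use borel_measurable_gauss in auto)
  then have "(\<lambda>k. fourier_const TYPE('a) * (LINT z|lborel. gauss z * ?I k z))
    \<longlonglongrightarrow> fourier_const TYPE('a) * (sqrt (2 * pi) ^ DIM('a) * (L2_norm f)\<^sup>2)"
    by (intro tendsto_mult tendsto_const) (simp add: integral_gauss)
  moreover have "fourier_const TYPE('a) * (sqrt (2 * pi) ^ DIM('a) * (L2_norm f)\<^sup>2) = (L2_norm f)\<^sup>2"
    unfolding fourier_const_eq by simp
  ultimately have "(\<lambda>k. LINT \<xi>|lborel. gauss (e k *\<^sub>R \<xi>) * (norm (fourier_integral f \<xi>))\<^sup>2) \<longlonglongrightarrow> (L2_norm f)\<^sup>2"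
    by (simp only: integral_gauss_fourier(2)[OF f1 f2 e(1)])
  then have "(\<lambda>k. ennreal (LINT \<xi>|lborel. gauss (e k *\<^sub>R \<xi>) * (norm (fourier_integral f \<xi>))\<^sup>2)) \<longlonglongrightarrow> ennreal ((L2_norm f)\<^sup>2)"
    by (rule tendsto_ennrealI)
  then have "(\<lambda>k. \<integral>\<^sup>+\<xi>. ennreal (gauss (e k *\<^sub>R \<xi>) * (norm (fourier_integral f \<xi>))\<^sup>2) \<partial>lborel) \<longlonglongrightarrow> ennreal ((L2_norm f)\<^sup>2)"
    by (subst nn_integral_eq_integral[OF integral_gauss_fourier(1)[OF f1 f2 e(1)]])
      (auto simp: less_imp_le[OF gauss_pos])
  moreover have "(\<lambda>k. \<integral>\<^sup>+\<xi>. ennreal (gauss (e k *\<^sub>R \<xi>) * (norm (fourier_integral f \<xi>))\<^sup>2) \<partial>lborel)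
    \<longlonglongrightarrow> (\<integral>\<^sup>+\<xi>. ennreal ((norm (fourier_integral f \<xi>))\<^sup>2) \<partial>lborel)"
  proof (rule nn_integral_LIMSEQ)
    have "gauss (e j *\<^sub>R \<xi>) \<le> gauss (e k *\<^sub>R \<xi>)" if "j \<le> k" for j k and \<xi> :: 'a
    proof -
      have "(e k * norm \<xi>)\<^sup>2 \<le> (e j * norm \<xi>)\<^sup>2"
        using decseqD[OF e(2) that] e(1)[of k] by (intro power_mono mult_right_mono) auto
      then show ?thesis using e(1) by (simp add: gauss_def abs_of_pos)
    qed
    then show "incseq (\<lambda>k \<xi>. ennreal (gauss (e k *\<^sub>R \<xi>) * (norm (fourier_integral f \<xi>))\<^sup>2))"
      by (auto simp: incseq_def le_fun_def intro!: ennreal_leI mult_right_mono)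
    show "(\<lambda>k. ennreal (gauss (e k *\<^sub>R \<xi>) * (norm (fourier_integral f \<xi>))\<^sup>2)) \<longlonglongrightarrow> ennreal ((norm (fourier_integral f \<xi>))\<^sup>2)" for \<xi>
    proof (rule tendsto_ennrealI)
      have "(\<lambda>k. exp (- (e k * norm \<xi>)\<^sup>2 / 2) * (norm (fourier_integral f \<xi>))\<^sup>2)
        \<longlonglongrightarrow> exp (- (0 * norm \<xi>)\<^sup>2 / 2) * (norm (fourier_integral f \<xi>))\<^sup>2"
        by (intro tendsto_intros e(3)) simp
      then show "(\<lambda>k. gauss (e k *\<^sub>R \<xi>) * (norm (fourier_integral f \<xi>))\<^sup>2) \<longlonglongrightarrow> (norm (fourier_integral f \<xi>))\<^sup>2"
        by (simp add: gauss_def power_mult_distrib)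
    qed
  qed measurable
  ultimately have nn: "(\<integral>\<^sup>+\<xi>. ennreal ((norm (fourier_integral f \<xi>))\<^sup>2) \<partial>lebesgue) = ennreal ((L2_norm f)\<^sup>2)"
    unfolding nn_integral_completion by (rule LIMSEQ_unique[rotated])
  then show F2: "fourier_integral f \<in> L2_space"
    by (simp add: L2_space_iff_nn_integral measurable_completion)
  from nn show "L2_norm (fourier_integral f) = L2_norm f"
    unfolding nn_integral_eq_L2_norm[OF F2] by (simp add: L2_norm_nonneg)
qed

text \<open>
  Fubini's theorem is applied to Borel functions only, since a function such as
  \<open>(x, h) \<mapsto> f (x - h)\<close> with \<open>f\<close> merely Lebesgue measurable is in general not measurable for the
  product of the completed measures. Statements about Lebesgue measurable functions are transferred
  through Borel representatives.
\<close>

lemma lebesgue_measurable_ex_borel_complex: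
  fixes f :: "'a::euclidean_space \<Rightarrow> complex"
  assumes "f \<in> borel_measurable lebesgue"
  obtains g where "g \<in> borel_measurable borel" "AE x in lebesgue. f x = g x"
proof -
  have "(\<lambda>x. Re (f x)) \<in> borel_measurable lebesgue" "(\<lambda>x. Im (f x)) \<in> borel_measurable lebesgue"
    using assms by measurable
  from this[THEN completion_ex_borel_measurable_real] obtain a b
    where [measurable]: "a \<in> borel_measurable lborel" "b \<in> borel_measurable lborel"
      and eq: "AE x in lborel. Re (f x) = a x" "AE x in lborel. Im (f x) = b x"
    by auto
  show thesis
  proof
    show "(\<lambda>x. Complex (a x) (b x)) \<in> borel_measurable borel"
      unfolding Complex_eq by measurable
    show "AE x in lebesgue. f x = Complex (a x) (b x)"
      by (intro AE_completion) (use eq in eventually_elim, simp add: complex_eq_iff)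
  qed
qed

theorem Plancherel:
  fixes f :: "'a::euclidean_space \<Rightarrow> complex"
  assumes f1: "integrable lebesgue f" and f2: "f \<in> L2_space"
  shows "fourier_integral f \<in> L2_space" "L2_norm (fourier_integral f) = L2_norm f"
proof -
  note fm = L2_space_measurable[OF f2]
  obtain g where g: "g \<in> borel_measurable borel" and eq: "AE x in lebesgue. f x = g x"
    using lebesgue_measurable_ex_borel_complex[OF fm] .
  have gm: "g \<in> borel_measurable lebesgue" using g by (simp add: measurable_completion)
  have g1: "integrable lborel g"
    using f1 integrable_cong_AE[OF fm gm eq] g by (simp add: integrable_completion)
  have g2: "g \<in> L2_space"
    by (rule L2_space_cong_AE[OF f2 gm]) (use eq in eventually_elim, simp)
  have "fourier_integral f = fourier_integral g"
    using fourier_integral_cong_AE[OF fm gm eq] by auto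
  then show "fourier_integral f \<in> L2_space" "L2_norm (fourier_integral f) = L2_norm f"
    using Plancherel_borel[OF g1 g2] L2_norm_cong_AE[OF fm gm eq] by auto
qed

section \<open>The Fourier transform of square-integrable functions\<close>

lemma fourier_multiplication_lebesgue:
  fixes f g :: "'a::euclidean_space \<Rightarrow> complex"
  assumes f: "integrable lebesgue f" and g: "integrable lebesgue g"
  shows "(LINT \<xi>|lebesgue. fourier_integral f \<xi> * g \<xi>) = (LINT x|lebesgue. f x * fourier_integral g x)"
proof -
  have fm: "f \<in> borel_measurable lebesgue" and gm: "g \<in> borel_measurable lebesgue" using f g by auto
  obtain f' where f' [measurable]: "f' \<in> borel_measurable borel" and ff': "AE x in lebesgue. f x = f' x"
    using lebesgue_measurable_ex_borel_complex[OF fm] .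
  obtain g' where g' [measurable]: "g' \<in> borel_measurable borel" and gg': "AE x in lebesgue. g x = g' x"
    using lebesgue_measurable_ex_borel_complex[OF gm] .
  have fm': "f' \<in> borel_measurable lebesgue" and gm': "g' \<in> borel_measurable lebesgue"
    by (simp_all add: measurable_completion)
  have f1: "integrable lborel f'" using f integrable_cong_AE[OF fm fm' ff'] by (simp add: integrable_completion)
  have g1: "integrable lborel g'" using g integrable_cong_AE[OF gm gm' gg'] by (simp add: integrable_completion)
  have F: "fourier_integral f = fourier_integral f'" "fourier_integral g = fourier_integral g'"
    using fourier_integral_cong_AE[OF fm fm' ff'] fourier_integral_cong_AE[OF gm gm' gg'] by auto
  have FM: "fourier_integral f' \<in> borel_measurable lebesgue" "fourier_integral g' \<in> borel_measurable lebesgue"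
    by (simp_all add: measurable_completion)
  have "(LINT \<xi>|lebesgue. fourier_integral f \<xi> * g \<xi>) = (LINT \<xi>|lebesgue. fourier_integral f' \<xi> * g' \<xi>)"
    unfolding F using gg' by (intro integral_cong_AE borel_measurable_times FM gm gm') (auto elim!: eventually_mono)
  also have "\<dots> = (LINT \<xi>|lborel. fourier_integral f' \<xi> * g' \<xi>)"
    by (rule integral_completion) measurable
  also have "\<dots> = (LINT x|lborel. f' x * fourier_integral g' x)"
    by (rule fourier_multiplication[OF f1 g1])
  also have "\<dots> = (LINT x|lebesgue. f' x * fourier_integral g' x)"
    by (rule integral_completion[symmetric]) measurable
  also have "\<dots> = (LINT x|lebesgue. f x * fourier_integral g x)"
    unfolding F using ff' by (intro integral_cong_AE borel_measurable_times FM fm fm') (auto elim!: eventually_mono)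
  finally show ?thesis .
qed

lemma fourier_integral_add_scaleR:
  fixes f g :: "'a::euclidean_space \<Rightarrow> complex"
  assumes f: "integrable lebesgue f" and g: "integrable lebesgue g"
  shows "fourier_integral (\<lambda>x. f x + c *\<^sub>R g x) \<xi> = fourier_integral f \<xi> + c *\<^sub>R fourier_integral g \<xi>"
proof -
  have m: "(\<lambda>x. - (x \<bullet> \<xi>)) \<in> borel_measurable lebesgue"
    by (intro measurable_completion) measurable
  note i = integrable_cis_mult[OF f m] integrable_cis_mult[OF g m]
  have "(LINT x|lebesgue. cis (- (x \<bullet> \<xi>)) * (f x + c *\<^sub>R g x))
    = (LINT x|lebesgue. cis (- (x \<bullet> \<xi>)) * f x + c *\<^sub>R (cis (- (x \<bullet> \<xi>)) * g x))"
    by (simp add: distrib_left)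
  also have "\<dots> = (LINT x|lebesgue. cis (- (x \<bullet> \<xi>)) * f x) + c *\<^sub>R (LINT x|lebesgue. cis (- (x \<bullet> \<xi>)) * g x)"
    using i by simp
  finally show ?thesis
    by (simp add: fourier_integral_def scaleR_add_right)
qed

lemma fourier_integral_diff:
  fixes f g :: "'a::euclidean_space \<Rightarrow> complex"
  assumes f: "integrable lebesgue f" and g: "integrable lebesgue g"
  shows "fourier_integral (\<lambda>x. f x - g x) \<xi> = fourier_integral f \<xi> - fourier_integral g \<xi>"
  using fourier_integral_add_scaleR[OF f g, of "-1"] by simp

lemma integrable_indicator_L2:
  assumes f: "f \<in> L2_space" and A: "A \<in> lmeasurable"
  shows "integrable lebesgue (\<lambda>x. indicator A x *\<^sub>R f x)"
proof (rule Bochner_Integration.integrable_bound)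
  show "integrable lebesgue (\<lambda>x. indicator A x + (norm (f x))\<^sup>2)"
    using f A by (auto simp: L2_space_def fmeasurable_def)
  show "(\<lambda>x. indicator A x *\<^sub>R f x) \<in> borel_measurable lebesgue"
    using L2_space_measurable[OF L2_space_indicator[OF f]] A by auto
  have "norm (f x) \<le> 1 + (norm (f x))\<^sup>2" for x
    using sum_squares_bound[of 1 "norm (f x)"] norm_ge_zero[of "f x"] by (simp del: norm_ge_zero)
  then show "AE x in lebesgue. norm (indicator A x *\<^sub>R f x) \<le> norm (indicator A x + (norm (f x))\<^sup>2)"
    by (intro AE_I2) (auto simp: indicator_def)
qed

text \<open>
  The truncations in the definition of \<open>is_fourier_L2\<close>.
\<close>

definition truncate_ball :: "nat \<Rightarrow> ('a::euclidean_space \<Rightarrow> 'b::euclidean_space) \<Rightarrow> 'a \<Rightarrow> 'b" where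
  "truncate_ball k f x = indicator (ball 0 (real k)) x *\<^sub>R f x"

lemma truncate_ball_L2: "f \<in> L2_space \<Longrightarrow> truncate_ball k f \<in> L2_space"
  unfolding truncate_ball_def[abs_def] by (rule L2_space_indicator) auto

lemma integrable_truncate_ball: "f \<in> L2_space \<Longrightarrow> integrable lebesgue (truncate_ball k f)"
  unfolding truncate_ball_def[abs_def] by (rule integrable_indicator_L2) auto

lemma truncate_ball_tendsto:
  "f \<in> L2_space \<Longrightarrow> (\<lambda>k. L2_norm (\<lambda>x. truncate_ball k f x - f x)) \<longlonglongrightarrow> 0"
  unfolding truncate_ball_def by (rule L2_truncation_tendsto)

lemma fourier_truncate_L2:
  assumes "f \<in> L2_space"
  shows "fourier_integral (truncate_ball k f) \<in> L2_space"
    "L2_norm (fourier_integral (truncate_ball k f)) = L2_norm (truncate_ball k f)"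
  using Plancherel[OF integrable_truncate_ball[OF assms] truncate_ball_L2[OF assms]] by auto

lemma is_fourier_L2_iff:
  "is_fourier_L2 f g \<longleftrightarrow> f \<in> L2_space \<and> g \<in> L2_space \<and>
     (\<lambda>k. L2_norm (\<lambda>\<xi>. fourier_integral (truncate_ball k f) \<xi> - g \<xi>)) \<longlonglongrightarrow> 0"
proof -
  have "(\<lambda>k. \<integral>\<^sup>+\<xi>. ennreal ((norm (fourier_integral (truncate_ball k f) \<xi> - g \<xi>))\<^sup>2) \<partial>lebesgue) \<longlonglongrightarrow> 0
    \<longleftrightarrow> (\<lambda>k. L2_norm (\<lambda>\<xi>. fourier_integral (truncate_ball k f) \<xi> - g \<xi>)) \<longlonglongrightarrow> 0"
    if f: "f \<in> L2_space" and g: "g \<in> L2_space"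
  proof -
    let ?n = "\<lambda>k. L2_norm (\<lambda>\<xi>. fourier_integral (truncate_ball k f) \<xi> - g \<xi>)"
    have "(\<lambda>k. ennreal ((?n k)\<^sup>2)) \<longlonglongrightarrow> ennreal 0 \<longleftrightarrow> (\<lambda>k. (?n k)\<^sup>2) \<longlonglongrightarrow> 0"
      by (rule tendsto_ennreal_iff) auto
    also have "\<dots> \<longleftrightarrow> ?n \<longlonglongrightarrow> 0"
      by (rule power_tendsto_0_iff) simp
    finally show ?thesis
      by (simp add: nn_integral_eq_L2_norm[OF L2_space_diff[OF fourier_truncate_L2(1)[OF f] g]])
  qed
  then show ?thesis
    unfolding is_fourier_L2_def truncate_ball_def[abs_def] by blast
qed

lemma is_fourier_L2_isometry:
  assumes "is_fourier_L2 f g" shows "L2_norm g = L2_norm f"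
proof -
  have f: "f \<in> L2_space" and g: "g \<in> L2_space"
    and lim: "(\<lambda>k. L2_norm (\<lambda>\<xi>. fourier_integral (truncate_ball k f) \<xi> - g \<xi>)) \<longlonglongrightarrow> 0"
    using assms by (auto simp: is_fourier_L2_iff)
  have "(\<lambda>k. L2_norm (truncate_ball k f)) \<longlonglongrightarrow> L2_norm g"
    using L2_norm_tendsto[OF g fourier_truncate_L2(1)[OF f] lim] by (simp add: fourier_truncate_L2(2)[OF f])
  moreover have "(\<lambda>k. L2_norm (truncate_ball k f)) \<longlonglongrightarrow> L2_norm f"
    by (rule L2_norm_tendsto[OF f truncate_ball_L2[OF f] truncate_ball_tendsto[OF f]])
  ultimately show ?thesis by (rule LIMSEQ_unique)
qed

lemma is_fourier_L2_add_scaleR: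
  assumes 1: "is_fourier_L2 f g" and 2: "is_fourier_L2 f' g'"
  shows "is_fourier_L2 (\<lambda>x. f x + c *\<^sub>R f' x) (\<lambda>\<xi>. g \<xi> + c *\<^sub>R g' \<xi>)"
proof -
  have f: "f \<in> L2_space" "f' \<in> L2_space" and g: "g \<in> L2_space" "g' \<in> L2_space"
    using 1 2 by (auto simp: is_fourier_L2_iff)
  let ?d = "\<lambda>k \<xi>. fourier_integral (truncate_ball k f) \<xi> - g \<xi>"
  let ?d' = "\<lambda>k \<xi>. fourier_integral (truncate_ball k f') \<xi> - g' \<xi>"
  have trunc: "truncate_ball k (\<lambda>x. f x + c *\<^sub>R f' x) = (\<lambda>x. truncate_ball k f x + c *\<^sub>R truncate_ball k f' x)" for k
    by (simp add: truncate_ball_def fun_eq_iff scaleR_add_right)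
  have eq: "fourier_integral (truncate_ball k (\<lambda>x. f x + c *\<^sub>R f' x)) \<xi> - (g \<xi> + c *\<^sub>R g' \<xi>) = ?d k \<xi> + c *\<^sub>R ?d' k \<xi>" for k \<xi>
    unfolding trunc fourier_integral_add_scaleR[OF integrable_truncate_ball[OF f(1)] integrable_truncate_ball[OF f(2)]]
    by (simp add: algebra_simps)
  have d: "?d k \<in> L2_space" "?d' k \<in> L2_space" for k
    by (intro L2_space_diff fourier_truncate_L2 f g)+
  have "(\<lambda>k. L2_norm (\<lambda>\<xi>. ?d k \<xi> + c *\<^sub>R ?d' k \<xi>)) \<longlonglongrightarrow> 0"
  proof (rule Lim_null_comparison)
    have "L2_norm (\<lambda>\<xi>. ?d k \<xi> + c *\<^sub>R ?d' k \<xi>) \<le> L2_norm (?d k) + \<bar>c\<bar> * L2_norm (?d' k)" for k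
      using L2_norm_triangle[OF d(1) L2_space_scaleR[OF d(2), of c]] by (simp only: L2_norm_scaleR)
    then show "\<forall>\<^sub>F k in sequentially. norm (L2_norm (\<lambda>\<xi>. ?d k \<xi> + c *\<^sub>R ?d' k \<xi>)) \<le> L2_norm (?d k) + \<bar>c\<bar> * L2_norm (?d' k)"
      by (intro always_eventually allI) (simp only: real_norm_def abs_of_nonneg[OF L2_norm_nonneg])
    have "(\<lambda>k. L2_norm (?d k) + \<bar>c\<bar> * L2_norm (?d' k)) \<longlonglongrightarrow> 0 + \<bar>c\<bar> * 0"
      using 1 2 by (intro tendsto_add tendsto_mult tendsto_const) (auto simp: is_fourier_L2_iff)
    then show "(\<lambda>k. L2_norm (?d k) + \<bar>c\<bar> * L2_norm (?d' k)) \<longlonglongrightarrow> 0" by simp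
  qed
  then show ?thesis
    unfolding is_fourier_L2_iff eq
    by (intro conjI L2_space_add[OF f(1) L2_space_scaleR[OF f(2)]] L2_space_add[OF g(1) L2_space_scaleR[OF g(2)]])
qed

lemma is_fourier_L2_diff_norm:
  assumes "is_fourier_L2 f g" "is_fourier_L2 f' g'"
  shows "L2_norm (\<lambda>\<xi>. g \<xi> - g' \<xi>) = L2_norm (\<lambda>x. f x - f' x)"
  using is_fourier_L2_isometry[OF is_fourier_L2_add_scaleR[OF assms, of "-1"]] by simp

lemma L2_norm_diff_eq_0_iff:
  assumes "f \<in> L2_space" "g \<in> L2_space"
  shows "L2_norm (\<lambda>x. f x - g x) = 0 \<longleftrightarrow> (AE x in lebesgue. f x = g x)"
  using L2_norm_eq_0_iff_AE[OF L2_space_diff[OF assms]] by simp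

text \<open>
  Taken with \<open>f = f'\<close> this is uniqueness of the transform, and with \<open>g = g'\<close> its injectivity.
\<close>

lemma is_fourier_L2_AE_eq_iff:
  assumes 1: "is_fourier_L2 f g" and 2: "is_fourier_L2 f' g'"
  shows "(AE \<xi> in lebesgue. g \<xi> = g' \<xi>) \<longleftrightarrow> (AE x in lebesgue. f x = f' x)"
  using is_fourier_L2_diff_norm[OF 1 2] 1 2
  by (simp add: L2_norm_diff_eq_0_iff[symmetric] is_fourier_L2_iff)

lemma is_fourier_L2_cong:
  assumes 1: "is_fourier_L2 f g" and f': "f' \<in> borel_measurable lebesgue" "AE x in lebesgue. f' x = f x"
    and g': "g' \<in> borel_measurable lebesgue" "AE x in lebesgue. g' x = g x"
  shows "is_fourier_L2 f' g'"
proof -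
  have f: "f \<in> L2_space" and g: "g \<in> L2_space" using 1 by (auto simp: is_fourier_L2_iff)
  have f2: "f' \<in> L2_space" by (rule L2_space_cong_AE[OF f f'])
  have g2: "g' \<in> L2_space" by (rule L2_space_cong_AE[OF g g'])
  have "fourier_integral (truncate_ball k f') = fourier_integral (truncate_ball k f)" for k
    by (intro ext fourier_integral_cong_AE L2_space_measurable truncate_ball_L2 f f2)
      (use f'(2) in eventually_elim, simp add: truncate_ball_def)
  moreover have "L2_norm (\<lambda>\<xi>. fourier_integral (truncate_ball k f) \<xi> - g' \<xi>) = L2_norm (\<lambda>\<xi>. fourier_integral (truncate_ball k f) \<xi> - g \<xi>)" for k
    by (intro L2_norm_cong_AE L2_space_measurable L2_space_diff fourier_truncate_L2 f g g2)
      (use g'(2) in eventually_elim, simp)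
  ultimately show ?thesis
    using 1 f2 g2 by (simp add: is_fourier_L2_iff)
qed

lemma is_fourier_L2_fourier_integral:
  assumes f1: "integrable lebesgue f" and f: "f \<in> L2_space"
  shows "is_fourier_L2 f (fourier_integral f)"
proof -
  have "L2_norm (\<lambda>\<xi>. fourier_integral (truncate_ball k f) \<xi> - fourier_integral f \<xi>) = L2_norm (\<lambda>x. truncate_ball k f x - f x)" for k
    using Plancherel(2)[OF Bochner_Integration.integrable_diff[OF integrable_truncate_ball[OF f] f1]
        L2_space_diff[OF truncate_ball_L2[OF f] f]]
    by (simp add: fourier_integral_diff[OF integrable_truncate_ball[OF f] f1, abs_def])
  then show ?thesis
    using truncate_ball_tendsto[OF f] f Plancherel(1)[OF f1 f] by (simp add: is_fourier_L2_iff)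
qed

lemma L2_of_real_iff:
  "(\<lambda>x. complex_of_real (u x)) \<in> L2_space \<longleftrightarrow> u \<in> L2_space"
proof
  assume "(\<lambda>x. complex_of_real (u x)) \<in> L2_space"
  then have [measurable]: "(\<lambda>x. complex_of_real (u x)) \<in> borel_measurable lebesgue"
    and "integrable lebesgue (\<lambda>x. (u x)\<^sup>2)"
    by (simp_all add: L2_space_def)
  moreover have "(\<lambda>x. Re (complex_of_real (u x))) \<in> borel_measurable lebesgue" by measurable
  ultimately show "u \<in> L2_space" by (simp add: L2_space_def)
qed (auto simp: L2_space_def)

lemma L2_norm_of_real: "L2_norm (\<lambda>x. complex_of_real (u x)) = L2_norm u"
  by (simp add: L2_norm_def)

lemma L2_inner_truncate:
  "L2_inner (truncate_ball k f) f = (L2_norm (truncate_ball k f))\<^sup>2"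
  unfolding L2_norm_power2 L2_inner_def
  by (intro Bochner_Integration.integral_cong) (auto simp: truncate_ball_def indicator_def)

text \<open>
  Replacing \<open>x\<close> by \<open>- x\<close> in the integral conjugates the integrand.
\<close>

lemma fourier_integral_Hermitian_real:
  fixes b :: "'a::euclidean_space \<Rightarrow> complex"
  assumes b [measurable]: "b \<in> borel_measurable borel" and herm: "\<And>x. b (- x) = cnj (b x)"
  shows "complex_of_real (Re (fourier_integral b \<xi>)) = fourier_integral b \<xi>"
proof -
  let ?f = "\<lambda>x. cis (- (x \<bullet> \<xi>)) * b x"
  have "(LINT x|lborel. ?f x) = (LINT x|lborel. ?f (- x))"
    using lborel_integral_affine[of ?f "-1" 0] by simp
  also have "\<dots> = (LINT x|lborel. cnj (?f x))"
    by (simp add: herm cis_cnj)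
  finally have "cnj (LINT x|lborel. ?f x) = (LINT x|lborel. ?f x)"
    unfolding Bochner_Integration.integral_cnj by simp
  then have "cnj (fourier_integral b \<xi>) = fourier_integral b \<xi>"
    by (simp add: fourier_integral_lborel)
  then show ?thesis by (metis Reals_cnj_iff of_real_Re)
qed

text \<open>
  The preimage is the limit \<open>W\<close> of the inverse transforms \<open>h k\<close> of the truncations of \<open>g\<close>, which
  are written here as transforms of conjugates. For a truncation \<open>T\<close> of \<open>W\<close>, the multiplication
  formula and continuity of the inner product give \<open>\<langle>F T, g\<rangle> = \<parallel>T\<parallel>\<^sup>2\<close>, where \<open>F T\<close> is the Fourier
  integral; with Plancherel's identity, \<open>\<parallel>F T - g\<parallel>\<^sup>2 = \<parallel>g\<parallel>\<^sup>2 - \<parallel>T\<parallel>\<^sup>2\<close>. As the truncations exhaust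
  \<open>W\<close> this tends to \<open>\<parallel>g\<parallel>\<^sup>2 - \<parallel>W\<parallel>\<^sup>2 = 0\<close>.
\<close>

theorem is_fourier_L2_surj:
  fixes g :: "'a::euclidean_space \<Rightarrow> complex"
  assumes gm [measurable]: "g \<in> borel_measurable borel" and g: "g \<in> L2_space"
    and herm: "\<And>\<xi>. g (- \<xi>) = cnj (g \<xi>)"
  obtains w where "w \<in> L2_space" "is_fourier_L2 (\<lambda>x. complex_of_real (w x)) g"
proof -
  \<comment> \<open>the Fourier integral of the conjugate is the conjugate of the inverse transform, which is real\<close>
  define b where "b k \<xi> = cnj (truncate_ball k g \<xi>)" for k \<xi>
  note tg = truncate_ball_L2[OF g] and tg1 = integrable_truncate_ball[OF g]
  have cnj_norm: "L2_norm (\<lambda>x. cnj (f x)) = L2_norm f" for f :: "'a \<Rightarrow> complex"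
    by (simp add: L2_norm_def)
  have b2: "b k \<in> L2_space" and b1: "integrable lebesgue (b k)" for k
    using tg[of k] tg1[of k] by (auto simp: b_def[abs_def] L2_space_def)
  define h where "h k = fourier_integral (b k)" for k
  have h2: "h k \<in> L2_space" for k unfolding h_def by (rule Plancherel(1)[OF b1 b2])
  define u where "u k x = Re (h k x)" for k x
  have h: "h k x = complex_of_real (u k x)" for k x
    unfolding u_def h_def
  proof (rule fourier_integral_Hermitian_real[symmetric])
    show "b k (- \<xi>) = cnj (b k \<xi>)" for \<xi>
      by (simp add: b_def truncate_ball_def herm indicator_def)
    show "b k \<in> borel_measurable borel"
      unfolding b_def[abs_def] truncate_ball_def[abs_def]
      by (intro measurable_compose[OF _ borel_measurable_cnj] borel_measurable_scaleR borel_measurable_indicator gm) simp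
  qed
  have h': "h k = (\<lambda>x. complex_of_real (u k x))" for k using h by blast
  have u2: "u k \<in> L2_space" for k
    using h2[of k] unfolding h' L2_of_real_iff .
  have h_diff: "L2_norm (\<lambda>x. u m x - u n x) = L2_norm (\<lambda>\<xi>. truncate_ball m g \<xi> - truncate_ball n g \<xi>)" for m n
  proof -
    have "L2_norm (\<lambda>x. u m x - u n x) = L2_norm (\<lambda>x. h m x - h n x)"
      unfolding h by (simp only: of_real_diff[symmetric] L2_norm_of_real)
    also have "(\<lambda>x. h m x - h n x) = fourier_integral (\<lambda>\<xi>. b m \<xi> - b n \<xi>)"
      unfolding h_def by (intro ext fourier_integral_diff[symmetric] b1)
    also have "L2_norm \<dots> = L2_norm (\<lambda>\<xi>. b m \<xi> - b n \<xi>)"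
      by (rule Plancherel(2)[OF Bochner_Integration.integrable_diff[OF b1 b1] L2_space_diff[OF b2 b2]])
    also have "\<dots> = L2_norm (\<lambda>\<xi>. truncate_ball m g \<xi> - truncate_ball n g \<xi>)"
      unfolding b_def complex_cnj_diff[symmetric] by (rule cnj_norm)
    finally show ?thesis .
  qed
  have "\<exists>N. \<forall>m\<ge>N. \<forall>n\<ge>N. L2_norm (\<lambda>x. u m x - u n x) < e" if "e > 0" for e
  proof -
    obtain N where N: "\<And>k. k \<ge> N \<Longrightarrow> L2_norm (\<lambda>\<xi>. truncate_ball k g \<xi> - g \<xi>) < e / 2"
      using LIMSEQ_D[OF truncate_ball_tendsto[OF g], of "e / 2"] \<open>e > 0\<close> by (auto simp: L2_norm_nonneg)
    have "L2_norm (\<lambda>x. u m x - u n x) < e" if "m \<ge> N" "n \<ge> N" for m n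
      using L2_norm_triangle_diff[OF tg g tg, of m n] N[OF that(1)] N[OF that(2)]
      unfolding h_diff L2_norm_diff_commute[of g] by linarith
    then show ?thesis by blast
  qed
  from L2_complete[OF u2 this] obtain w where w: "w \<in> L2_space"
    and uw: "(\<lambda>k. L2_norm (\<lambda>x. u k x - w x)) \<longlonglongrightarrow> 0" by metis
  define W where "W x = complex_of_real (w x)" for x
  have W: "W \<in> L2_space" using w by (simp add: W_def[abs_def] L2_of_real_iff)
  have hW: "(\<lambda>k. L2_norm (\<lambda>x. h k x - W x)) \<longlonglongrightarrow> 0"
    using uw unfolding h W_def by (simp only: of_real_diff[symmetric] L2_norm_of_real)
  note FT = fourier_truncate_L2[OF W]
  have norm_h: "L2_norm (h k) = L2_norm (truncate_ball k g)" for k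
    unfolding h_def Plancherel(2)[OF b1 b2] unfolding b_def by (rule cnj_norm)
  have norm_W: "L2_norm W = L2_norm g"
    using L2_norm_tendsto[OF W h2 hW] L2_norm_tendsto[OF g tg truncate_ball_tendsto[OF g]]
    unfolding norm_h by (rule LIMSEQ_unique)
  have inner: "L2_inner (fourier_integral (truncate_ball m W)) g = (L2_norm (truncate_ball m W))\<^sup>2" for m
  proof -
    note TW1 = integrable_truncate_ball[OF W] and TW2 = truncate_ball_L2[OF W]
    have "L2_inner (truncate_ball k g) (fourier_integral (truncate_ball m W)) = L2_inner (h k) (truncate_ball m W)" for k
    proof -
      have "L2_inner (truncate_ball k g) (fourier_integral (truncate_ball m W))
        = (LINT \<xi>|lebesgue. Re (fourier_integral (truncate_ball m W) \<xi> * b k \<xi>))"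
        unfolding L2_inner_def b_def by (simp add: inner_complex_def mult.commute)
      also have "\<dots> = Re (LINT \<xi>|lebesgue. fourier_integral (truncate_ball m W) \<xi> * b k \<xi>)"
      proof (rule integral_Re)
        have "integrable lebesgue (\<lambda>\<xi>. norm (fourier_integral (truncate_ball m W) \<xi>) * norm (b k \<xi>))"
          using integrable_L2_inner[OF L2_space_norm[OF FT(1)] L2_space_norm[OF b2]] by simp
        then show "integrable lebesgue (\<lambda>\<xi>. fourier_integral (truncate_ball m W) \<xi> * b k \<xi>)"
          by (rule Bochner_Integration.integrable_bound)
            (auto simp: norm_mult intro!: borel_measurable_times L2_space_measurable[OF FT(1)] L2_space_measurable[OF b2])
      qed
      also have "\<dots> = Re (LINT x|lebesgue. truncate_ball m W x * h k x)"
        unfolding h_def by (simp only: fourier_multiplication_lebesgue[OF TW1 b1])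
      also have "\<dots> = (LINT x|lebesgue. Re (truncate_ball m W x * h k x))"
      proof (rule integral_Re[symmetric])
        have "integrable lebesgue (\<lambda>x. norm (truncate_ball m W x) * norm (h k x))"
          using integrable_L2_inner[OF L2_space_norm[OF TW2] L2_space_norm[OF h2]] by simp
        then show "integrable lebesgue (\<lambda>x. truncate_ball m W x * h k x)"
          by (rule Bochner_Integration.integrable_bound)
            (auto simp: norm_mult intro!: borel_measurable_times L2_space_measurable[OF TW2] L2_space_measurable[OF h2])
      qed
      also have "\<dots> = L2_inner (h k) (truncate_ball m W)"
        unfolding L2_inner_def by (simp add: inner_complex_def h mult.commute)
      finally show ?thesis .
    qed
    then have "(\<lambda>k. L2_inner (h k) (truncate_ball m W)) \<longlonglongrightarrow> L2_inner g (fourier_integral (truncate_ball m W))"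
      using L2_inner_tendsto[OF g tg FT(1)[of m] truncate_ball_tendsto[OF g]] by (simp only:)
    moreover have "(\<lambda>k. L2_inner (h k) (truncate_ball m W)) \<longlonglongrightarrow> L2_inner W (truncate_ball m W)"
      by (rule L2_inner_tendsto[OF W h2 TW2 hW])
    ultimately have "L2_inner g (fourier_integral (truncate_ball m W)) = L2_inner W (truncate_ball m W)"
      by (rule LIMSEQ_unique)
    then show ?thesis
      by (simp add: L2_inner_commute[of g] L2_inner_commute[of W] L2_inner_truncate)
  qed
  have "(L2_norm (\<lambda>\<xi>. fourier_integral (truncate_ball m W) \<xi> - g \<xi>))\<^sup>2 = (L2_norm g)\<^sup>2 - (L2_norm (truncate_ball m W))\<^sup>2" for m
    by (simp add: L2_norm_diff_power2[OF FT(1) g] inner FT(2))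
  moreover have "(\<lambda>m. (L2_norm g)\<^sup>2 - (L2_norm (truncate_ball m W))\<^sup>2) \<longlonglongrightarrow> (L2_norm g)\<^sup>2 - (L2_norm W)\<^sup>2"
    by (intro tendsto_diff tendsto_const tendsto_power
        L2_norm_tendsto[OF W truncate_ball_L2[OF W] truncate_ball_tendsto[OF W]])
  ultimately have "(\<lambda>m. (L2_norm (\<lambda>\<xi>. fourier_integral (truncate_ball m W) \<xi> - g \<xi>))\<^sup>2) \<longlonglongrightarrow> 0"
    by (simp add: norm_W)
  then have "(\<lambda>m. L2_norm (\<lambda>\<xi>. fourier_integral (truncate_ball m W) \<xi> - g \<xi>)) \<longlonglongrightarrow> 0"
    by simp
  then have "is_fourier_L2 W g" using W g by (simp add: is_fourier_L2_iff)
  then show thesis using that[OF w] by (simp add: W_def[abs_def])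
qed

section \<open>The fractional energy\<close>

text \<open>
  The squared norm of \<open>(-\<Delta>)\<^sup>s\<^sup>/\<^sup>2 u\<close> for integrable \<open>u\<close>, computed from the Fourier integral. The value is
  infinite when \<open>u\<close> is square-integrable but not in \<open>Hs s\<close>, so membership can be decided by
  estimating it.
\<close>

definition fractional_energy :: "real \<Rightarrow> ('a::euclidean_space \<Rightarrow> real) \<Rightarrow> ennreal" where
  "fractional_energy s u =
     (\<integral>\<^sup>+\<xi>. ennreal ((norm (norm \<xi> powr s *\<^sub>R fourier_integral (\<lambda>x. complex_of_real (u x)) \<xi>))\<^sup>2) \<partial>lebesgue)"

lemma fractional_energy_cong_AE:
  assumes "u \<in> borel_measurable lebesgue" "v \<in> borel_measurable lebesgue" "AE x in lebesgue. u x = v x"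
  shows "fractional_energy s u = fractional_energy s v"
proof -
  have "fourier_integral (\<lambda>x. complex_of_real (u x)) = fourier_integral (\<lambda>x. complex_of_real (v x))"
    by (intro ext fourier_integral_cong_AE)
      (use assms in \<open>auto elim!: eventually_mono\<close>)
  then show ?thesis by (simp add: fractional_energy_def)
qed

lemma fourier_integral_translate:
  fixes f :: "'a::euclidean_space \<Rightarrow> complex"
  assumes [measurable]: "f \<in> borel_measurable borel"
  shows "fourier_integral (\<lambda>x. f (x + h)) \<xi> = cis (h \<bullet> \<xi>) * fourier_integral f \<xi>"
proof -
  have "(LINT x|lborel. cis (- (x \<bullet> \<xi>)) * f x) = (LINT x|lborel. cis (- ((h + x) \<bullet> \<xi>)) * f (h + x))"
    using lborel_integral_affine[of "\<lambda>x. cis (- (x \<bullet> \<xi>)) * f x" 1 h] by simp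
  then have "cis (h \<bullet> \<xi>) * (LINT x|lborel. cis (- (x \<bullet> \<xi>)) * f x)
    = (LINT x|lborel. cis (h \<bullet> \<xi>) * (cis (- ((h + x) \<bullet> \<xi>)) * f (h + x)))"
    by simp
  also have "\<dots> = (LINT x|lborel. cis (- (x \<bullet> \<xi>)) * f (x + h))"
    by (rule Bochner_Integration.integral_cong)
      (simp_all add: cis_mult inner_add_left add.commute flip: mult.assoc)
  finally show ?thesis by (simp add: fourier_integral_lborel)
qed

text \<open>
  This is Plancherel's identity for the increment, since translation by \<open>h\<close> multiplies the
  transform by \<open>cis (h \<bullet> \<xi>)\<close>.
\<close>

lemma increment_L2:
  fixes u :: "'a::euclidean_space \<Rightarrow> real"
  assumes u1: "integrable lborel u" and u2: "u \<in> L2_space"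
  shows "(\<integral>\<^sup>+x. ennreal ((u (x + h) - u x)\<^sup>2) \<partial>lborel)
    = (\<integral>\<^sup>+\<xi>. ennreal ((norm (cis (h \<bullet> \<xi>) - 1))\<^sup>2 * (norm (fourier_integral (\<lambda>x. complex_of_real (u x)) \<xi>))\<^sup>2) \<partial>lborel)"
proof -
  have um [measurable]: "u \<in> borel_measurable borel" using u1 by auto
  define U where "U x = complex_of_real (u x)" for x
  have Um [measurable]: "U \<in> borel_measurable borel" unfolding U_def[abs_def] by measurable
  have U1: "integrable lborel U" using u1 by (simp add: U_def[abs_def])
  have U2: "U \<in> L2_space" using u2 by (simp add: U_def[abs_def] L2_of_real_iff)
  have Uh1: "integrable lborel (\<lambda>x. U (x + h))"
    using lborel_integrable_affine[OF U1, of 1 h] by (simp add: add.commute)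
  note Uh2 = L2_translate(1)[OF Um U2, of h]
  let ?d = "\<lambda>x. U (x + h) - U x"
  have d1: "integrable lebesgue ?d" "integrable lborel ?d"
    using U1 Uh1 by (simp_all add: integrable_completion)
  have d2: "?d \<in> L2_space" by (rule L2_space_diff[OF Uh2 U2])
  have F: "fourier_integral ?d \<xi> = (cis (h \<bullet> \<xi>) - 1) * fourier_integral U \<xi>" for \<xi>
  proof -
    have "fourier_integral ?d \<xi> = fourier_integral (\<lambda>x. U (x + h)) \<xi> - fourier_integral U \<xi>"
      by (rule fourier_integral_diff) (use U1 Uh1 in \<open>simp_all add: integrable_completion\<close>)
    then show ?thesis by (simp add: fourier_integral_translate algebra_simps)
  qed
  have "(\<integral>\<^sup>+x. ennreal ((u (x + h) - u x)\<^sup>2) \<partial>lborel) = (\<integral>\<^sup>+x. ennreal ((norm (?d x))\<^sup>2) \<partial>lebesgue)"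
    unfolding U_def of_real_diff[symmetric] norm_of_real nn_integral_completion by simp
  also have "\<dots> = (\<integral>\<^sup>+\<xi>. ennreal ((norm (fourier_integral ?d \<xi>))\<^sup>2) \<partial>lebesgue)"
    using Plancherel[OF d1(1) d2] d2 by (simp add: nn_integral_eq_L2_norm)
  finally show ?thesis
    unfolding F nn_integral_completion by (simp add: norm_mult power_mult_distrib U_def[abs_def])
qed

section \<open>The energy as an average of increments\<close>

text \<open>
  The radial integrand that remains of the jump average below once the Gaussian variable
  has been integrated out; its integral is the factor in front of \<open>(norm \<xi>)\<^sup>2\<^sup>s\<close>.
\<close>

definition profile :: "real \<Rightarrow> real \<Rightarrow> real" where
  "profile s r = indicator {0<..} r * (r powr (- 1 - 2 * s) * (1 - exp (- r\<^sup>2 / 2)))"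

lemma profile_pos: "0 < r \<Longrightarrow> 0 < profile s r"
  by (simp add: profile_def)

lemma borel_measurable_profile [measurable]: "profile s \<in> borel_measurable borel"
  unfolding profile_def by measurable

definition profile_mass :: "real \<Rightarrow> ennreal" where
  "profile_mass s = (\<integral>\<^sup>+r. ennreal (profile s r) \<partial>lborel)"

lemma profile_mass_pos: "profile_mass s \<noteq> 0"
proof
  assume "profile_mass s = 0"
  then have "AE r in lborel. ennreal (profile s r) = 0"
    unfolding profile_mass_def by (subst (asm) nn_integral_0_iff_AE) auto
  then have "AE r in lborel. r \<notin> {0<..<1::real}"
  proof eventually_elim
    fix r :: real assume "ennreal (profile s r) = 0"
    then show "r \<notin> {0<..<1}" using profile_pos[of r s] by (auto simp: ennreal_eq_0_iff)
  qed
  then have "emeasure lborel {0<..<1::real} = 0"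
    by (subst (asm) AE_iff_measurable[where N="{0<..<1}"]) auto
  then show False by simp
qed

text \<open>
  Both bounds on \<open>s\<close> enter here: near \<open>0\<close> the profile is at most \<open>r powr (1 - 2 * s)\<close>, integrable
  because \<open>s < 1\<close>, and near infinity it is at most \<open>r powr (- 1 - 2 * s)\<close>, integrable because
  \<open>0 < s\<close>.
\<close>

lemma profile_mass_finite:
  assumes s: "0 < s" "s < 1"
  shows "profile_mass s < \<infinity>"
proof -
  let ?b1 = "\<lambda>r. indicator {0..1} r * r powr (1 - 2 * s)"
  let ?b2 = "\<lambda>r. indicator {1..} r * r powr (- 1 - 2 * s)"
  have le: "profile s r \<le> ?b1 r + ?b2 r" for r
  proof -
    consider "r \<le> 0" | "0 < r" "r \<le> 1" | "1 < r" by linarith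
    then show ?thesis
    proof cases
      case 2
      have "1 - exp (- r\<^sup>2 / 2) \<le> r\<^sup>2"
        using exp_ge_add_one_self[of "- r\<^sup>2 / 2"] zero_le_power2[of r] by linarith
      then have "r powr (- 1 - 2 * s) * (1 - exp (- r\<^sup>2 / 2)) \<le> r powr (- 1 - 2 * s) * r\<^sup>2"
        by (intro mult_left_mono) auto
      also have "\<dots> = r powr (1 - 2 * s)"
        using 2 by (simp add: powr_add[symmetric] flip: powr_numeral)
      also have "\<dots> \<le> r powr (1 - 2 * s) + ?b2 r" by simp
      finally show ?thesis using 2 by (simp add: profile_def)
    next
      case 3
      have "r powr (- 1 - 2 * s) * (1 - exp (- r\<^sup>2 / 2)) \<le> r powr (- 1 - 2 * s) * 1"
        by (intro mult_left_mono) auto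
      then show ?thesis using 3 by (simp add: profile_def indicator_def)
    qed (simp add: profile_def indicator_def)
  qed
  have "profile_mass s \<le> (\<integral>\<^sup>+r. ennreal (?b1 r) + ennreal (?b2 r) \<partial>lborel)"
    unfolding profile_mass_def using le
    by (intro nn_integral_mono) (simp add: ennreal_leI flip: ennreal_plus)
  also have "\<dots> = (\<integral>\<^sup>+r. ennreal (?b1 r) \<partial>lborel) + (\<integral>\<^sup>+r. ennreal (?b2 r) \<partial>lborel)"
    by (rule nn_integral_add) measurable
  also have "(\<integral>\<^sup>+r. ennreal (?b1 r) \<partial>lborel) = ennreal (1 powr (1 - 2 * s + 1) / (1 - 2 * s + 1))"
    by (rule nn_integral_has_integral_lebesgue[OF _ has_integral_powr_from_0]) (use s in auto)
  also have "(\<integral>\<^sup>+r. ennreal (?b2 r) \<partial>lborel) = ennreal (- (1 powr (- 1 - 2 * s + 1)) / (- 1 - 2 * s + 1))"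
    by (rule nn_integral_has_integral_lebesgue[OF _ has_integral_powr_to_inf]) (use s in auto)
  finally show ?thesis by (simp add: le_less_trans flip: ennreal_plus)
qed

text \<open>
  Substituting \<open>r / a\<close> for \<open>r\<close> shows that the integral is homogeneous of degree \<open>2 * s\<close> in \<open>a\<close>.
\<close>

lemma profile_scaling:
  assumes a: "0 \<le> a" and s: "0 < s"
  shows "(\<integral>\<^sup>+r. ennreal (indicator {0<..} r * (r powr (- 1 - 2 * s) * (1 - exp (- (r * a)\<^sup>2 / 2)))) \<partial>lborel)
    = ennreal ((a powr s)\<^sup>2) * profile_mass s"
proof (cases "a = 0")
  case True
  then show ?thesis by simp
next
  case False
  with a have a: "0 < a" by simp
  let ?f = "\<lambda>r. ennreal (indicator {0<..} r * (r powr (- 1 - 2 * s) * (1 - exp (- (r * a)\<^sup>2 / 2))))"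
  have eq: "?f (0 + (1 / a) * r) = ennreal (a * (a powr s)\<^sup>2) * ennreal (profile s r)" for r
  proof (cases "r > 0")
    case True
    have "(r / a) powr (- 1 - 2 * s) = r powr (- 1 - 2 * s) * (a * (a powr s)\<^sup>2)"
    proof -
      have "(r / a) powr (- 1 - 2 * s) = r powr (- 1 - 2 * s) / a powr (- 1 - 2 * s)"
        using True a by (simp add: powr_divide)
      also have "\<dots> = r powr (- 1 - 2 * s) * a powr (1 + (s + s))"
      proof -
        have "1 + (s + s) = - (- 1 - 2 * s)" by simp
        then have "a powr (1 + (s + s)) = 1 / a powr (- 1 - 2 * s)" by (simp only: powr_minus_divide)
        then show ?thesis by simp
      qed
      also have "a powr (1 + (s + s)) = a * (a powr s)\<^sup>2"
        using a by (simp only: powr_add power2_eq_square) simp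
      finally show ?thesis .
    qed
    then show ?thesis
      using True a by (simp add: profile_def ennreal_mult'[symmetric] mult_ac)
  next
    case False
    then show ?thesis using a by (simp add: profile_def indicator_def zero_less_divide_iff)
  qed
  have "(\<integral>\<^sup>+r. ?f r \<partial>lborel) = ennreal \<bar>1 / a\<bar> * (\<integral>\<^sup>+r. ?f (0 + (1 / a) * r) \<partial>lborel)"
    by (rule nn_integral_real_affine) (use a in auto)
  also have "\<dots> = ennreal (1 / a) * (ennreal (a * (a powr s)\<^sup>2) * profile_mass s)"
    unfolding eq profile_mass_def using a by (subst nn_integral_cmult) auto
  also have "\<dots> = ennreal ((a powr s)\<^sup>2) * profile_mass s"
    using a by (simp add: mult.assoc[symmetric] ennreal_mult[symmetric])
  finally show ?thesis .
qed

lemma gauss_cis_integral: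
  fixes \<xi> :: "'a::euclidean_space"
  shows "(\<integral>\<^sup>+z. ennreal (gauss z * (norm (cis (z \<bullet> \<xi>) - 1))\<^sup>2) \<partial>lborel)
    = ennreal (2 * sqrt (2 * pi) ^ DIM('a) * (1 - gauss \<xi>))"
proof -
  have sq: "(norm (cis t - 1))\<^sup>2 = 2 - 2 * cos t" for t
  proof -
    have "(norm (cis t - 1))\<^sup>2 = (cos t - 1)\<^sup>2 + (sin t)\<^sup>2"
      by (simp add: cmod_power2)
    also have "\<dots> = (cos t)\<^sup>2 + (sin t)\<^sup>2 + 1 - 2 * cos t"
      by (simp add: power2_eq_square algebra_simps)
    finally show ?thesis by simp
  qed
  note F = fourier_gauss_lborel[of \<xi>]
  have Re_eq: "Re (cis (- (z \<bullet> \<xi>)) * complex_of_real (gauss z)) = cos (z \<bullet> \<xi>) * gauss z" for z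
    by simp
  have i: "integrable lborel (\<lambda>z. cos (z \<bullet> \<xi>) * gauss z)"
    using integrable_Re[OF F(1)] unfolding Re_eq .
  have v: "(LINT z|lborel. cos (z \<bullet> \<xi>) * gauss z) = sqrt (2 * pi) ^ DIM('a) * gauss \<xi>"
    using integral_Re[OF F(1)] unfolding Re_eq F(2) by simp
  have "(\<integral>\<^sup>+z. ennreal (gauss z * (norm (cis (z \<bullet> \<xi>) - 1))\<^sup>2) \<partial>lborel)
    = ennreal (LINT z|lborel. gauss z * (norm (cis (z \<bullet> \<xi>) - 1))\<^sup>2)"
  proof (rule nn_integral_eq_integral)
    show "integrable lborel (\<lambda>z. gauss z * (norm (cis (z \<bullet> \<xi>) - 1))\<^sup>2)"
    proof -
      have "integrable lborel (\<lambda>z. 2 * gauss z - 2 * (cos (z \<bullet> \<xi>) * gauss z))"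
        by (intro Bochner_Integration.integrable_diff integrable_mult_right i integrable_gauss)
      then show ?thesis unfolding sq by (simp add: right_diff_distrib mult_ac)
    qed
  qed (simp add: less_imp_le[OF gauss_pos])
  also have "(LINT z|lborel. gauss z * (norm (cis (z \<bullet> \<xi>) - 1))\<^sup>2)
    = (LINT z|lborel. 2 * gauss z - 2 * (cos (z \<bullet> \<xi>) * gauss z))"
    unfolding sq by (simp add: right_diff_distrib mult_ac)
  also have "\<dots> = 2 * sqrt (2 * pi) ^ DIM('a) * (1 - gauss \<xi>)"
    using i integrable_gauss[where 'a='a] by (simp add: v integral_gauss right_diff_distrib)
  finally show ?thesis .
qed

text \<open>
  A weight on pairs \<open>(r, z)\<close> of a scale \<open>r\<close> and a Gaussian vector \<open>z\<close>. Its image under \<open>(r, z) \<mapsto> r *\<^sub>R z\<close> is a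
  multiple of the kernel \<open>\<bar>h\<bar> powr (- n - 2 * s)\<close> of the Gagliardo seminorm, where \<open>n\<close> is the dimension.
  In these coordinates rotation invariance is that of the Gaussian and homogeneity is a
  one-dimensional substitution.
\<close>

definition jump_weight :: "real \<Rightarrow> real \<times> 'a::euclidean_space \<Rightarrow> real" where
  "jump_weight s p = indicator {0<..} (fst p) * fst p powr (- 1 - 2 * s) * gauss (snd p)"

lemma borel_measurable_jump_weight [measurable]:
  "jump_weight s \<in> borel_measurable borel"
  unfolding jump_weight_def borel_prod[symmetric] by measurable

lemma jump_weight_nonneg: "0 \<le> jump_weight s p"
  by (simp add: jump_weight_def less_imp_le[OF gauss_pos])

definition symbol_const :: "'a::euclidean_space itself \<Rightarrow> real \<Rightarrow> ennreal" where
  "symbol_const _ s = ennreal (2 * sqrt (2 * pi) ^ DIM('a)) * profile_mass s"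

lemma symbol_const_pos: "symbol_const TYPE('a::euclidean_space) s \<noteq> 0"
  by (simp add: symbol_const_def profile_mass_pos ennreal_eq_0_iff not_le)

lemma symbol_const_finite:
  "0 < s \<Longrightarrow> s < 1 \<Longrightarrow> symbol_const TYPE('a::euclidean_space) s \<noteq> top"
  using profile_mass_finite[of s] by (simp add: symbol_const_def ennreal_mult_eq_top_iff less_top)

definition jump :: "real \<times> 'a::euclidean_space \<Rightarrow> 'a" where
  "jump p = fst p *\<^sub>R snd p"

lemma borel_measurable_jump [measurable]: "jump \<in> borel_measurable borel"
  unfolding jump_def[abs_def] borel_prod[symmetric] by measurable

text \<open>
  Integration over \<open>z\<close> produces \<open>1 - gauss (r *\<^sub>R \<xi>)\<close>, which depends on \<open>norm \<xi>\<close> only; the remaining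
  integral over \<open>r\<close> is the homogeneous one of \<open>profile_scaling\<close>.
\<close>

lemma jump_symbol:
  fixes \<xi> :: "'a::euclidean_space"
  assumes s: "0 < s"
  shows "(\<integral>\<^sup>+p. ennreal (jump_weight s p * (norm (cis ((jump p) \<bullet> \<xi>) - 1))\<^sup>2) \<partial>lborel)
    = symbol_const TYPE('a) s * ennreal ((norm \<xi> powr s)\<^sup>2)"
proof -
  let ?w = "\<lambda>r. indicator {0<..} r * r powr (- 1 - 2 * s)"
  let ?f = "\<lambda>p :: real \<times> 'a. ennreal (jump_weight s p * (norm (cis ((jump p) \<bullet> \<xi>) - 1))\<^sup>2)"
  let ?K = "2 * sqrt (2 * pi) ^ DIM('a)"
  have "(\<integral>\<^sup>+p. ?f p \<partial>lborel) = (\<integral>\<^sup>+r. \<integral>\<^sup>+z. ?f (r, z) \<partial>lborel \<partial>lborel)"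
    by (subst lborel.nn_integral_fst) (simp_all add: lborel_prod)
  also have "\<dots> = (\<integral>\<^sup>+r. ennreal ?K * ennreal (?w r * (1 - exp (- (r * norm \<xi>)\<^sup>2 / 2))) \<partial>lborel)"
  proof (rule nn_integral_cong)
    fix r :: real
    have "(\<integral>\<^sup>+z. ?f (r, z) \<partial>lborel) = (\<integral>\<^sup>+z. ennreal (?w r) * ennreal (gauss z * (norm (cis (z \<bullet> (r *\<^sub>R \<xi>)) - 1))\<^sup>2) \<partial>lborel)"
      by (intro nn_integral_cong) (simp add: jump_def jump_weight_def ennreal_mult'[symmetric] mult_ac)
    also have "\<dots> = ennreal (?w r) * ennreal (?K * (1 - gauss (r *\<^sub>R \<xi>)))"
      by (subst nn_integral_cmult, measurable) (simp only: gauss_cis_integral)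
    also have "\<dots> = ennreal ?K * ennreal (?w r * (1 - exp (- (r * norm \<xi>)\<^sup>2 / 2)))"
      by (simp add: gauss_def power_mult_distrib mult_ac flip: ennreal_mult' ennreal_mult'')
    finally show "(\<integral>\<^sup>+z. ?f (r, z) \<partial>lborel) = ennreal ?K * ennreal (?w r * (1 - exp (- (r * norm \<xi>)\<^sup>2 / 2)))" .
  qed
  also have "\<dots> = ennreal ?K * (ennreal ((norm \<xi> powr s)\<^sup>2) * profile_mass s)"
    by (subst nn_integral_cmult, measurable) (simp only: profile_scaling[OF norm_ge_zero s] mult.assoc)
  finally show ?thesis by (simp add: symbol_const_def mult_ac)
qed

text \<open>
  The energy as a superposition of squared norms of increments: for each \<open>\<xi>\<close> the average of
  \<open>(norm (cis (h \<bullet> \<xi>) - 1))\<^sup>2\<close> over the jumps \<open>h\<close> is a multiple of \<open>(norm \<xi>)\<^sup>2\<^sup>s\<close>, and Tonelli's theorem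
  exchanges this average with the integral over \<open>\<xi>\<close>.
\<close>

lemma fractional_energy_jump:
  fixes u :: "'a::euclidean_space \<Rightarrow> real"
  assumes u1: "integrable lborel u" and u2: "u \<in> L2_space" and s: "0 < s"
  shows "symbol_const TYPE('a) s * fractional_energy s u
    = (\<integral>\<^sup>+p. ennreal (jump_weight s p) * (\<integral>\<^sup>+x. ennreal ((u (x + jump p) - u x)\<^sup>2) \<partial>lborel) \<partial>lborel)"
proof -
  have um [measurable]: "u \<in> borel_measurable borel" using u1 by auto
  define F where "F = fourier_integral (\<lambda>x. complex_of_real (u x))"
  have [measurable]: "F \<in> borel_measurable borel" unfolding F_def by measurable
  let ?c = "\<lambda>p \<xi>. (norm (cis ((jump p) \<bullet> \<xi>) - 1))\<^sup>2"
  let ?g = "\<lambda>p \<xi>. ennreal (jump_weight s p * ?c p \<xi>) * ennreal ((norm (F \<xi>))\<^sup>2)"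
  have "(\<integral>\<^sup>+p. ennreal (jump_weight s p) * (\<integral>\<^sup>+x. ennreal ((u (x + jump p) - u x)\<^sup>2) \<partial>lborel) \<partial>lborel)
    = (\<integral>\<^sup>+p. \<integral>\<^sup>+\<xi>. ?g p \<xi> \<partial>lborel \<partial>lborel)"
    unfolding increment_L2[OF u1 u2] F_def[symmetric]
    by (intro nn_integral_cong, subst nn_integral_cmult[symmetric])
      (auto simp: jump_weight_nonneg ennreal_mult mult.assoc)
  also have "\<dots> = (\<integral>\<^sup>+\<xi>. \<integral>\<^sup>+p. ?g p \<xi> \<partial>lborel \<partial>lborel)"
    by (rule lborel_pair.Fubini'[symmetric]) measurable
  also have "\<dots> = (\<integral>\<^sup>+\<xi>. symbol_const TYPE('a) s * ennreal ((norm (norm \<xi> powr s *\<^sub>R F \<xi>))\<^sup>2) \<partial>lborel)"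
  proof (rule nn_integral_cong)
    fix \<xi>
    have "(\<integral>\<^sup>+p. ?g p \<xi> \<partial>lborel) = symbol_const TYPE('a) s * ennreal ((norm \<xi> powr s)\<^sup>2) * ennreal ((norm (F \<xi>))\<^sup>2)"
      by (subst nn_integral_multc) (simp_all only: jump_symbol[OF s], measurable)
    then show "(\<integral>\<^sup>+p. ?g p \<xi> \<partial>lborel) = symbol_const TYPE('a) s * ennreal ((norm (norm \<xi> powr s *\<^sub>R F \<xi>))\<^sup>2)"
      by (simp add: power_mult_distrib ennreal_mult mult.assoc)
  qed
  also have "\<dots> = symbol_const TYPE('a) s * (\<integral>\<^sup>+\<xi>. ennreal ((norm (norm \<xi> powr s *\<^sub>R F \<xi>))\<^sup>2) \<partial>lborel)"
    by (rule nn_integral_cmult) measurable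
  finally show ?thesis
    by (simp add: fractional_energy_def nn_integral_completion F_def)
qed

lemma Lipschitz_compose:
  fixes \<eta> :: "real \<Rightarrow> real" and u :: "'a::euclidean_space \<Rightarrow> real"
  assumes lip: "\<And>a b. \<bar>\<eta> a - \<eta> b\<bar> \<le> \<bar>a - b\<bar>" and zero: "\<eta> 0 = 0"
  shows "\<eta> \<in> borel_measurable borel"
    and "integrable M v \<Longrightarrow> integrable M (\<lambda>x. \<eta> (v x))"
    and "u \<in> L2_space \<Longrightarrow> (\<lambda>x. \<eta> (u x)) \<in> L2_space"
proof -
  have "continuous_on UNIV \<eta>"
    by (rule lipschitz_on_continuous_on[of 1]) (use lip in \<open>simp add: lipschitz_on_def dist_real_def\<close>)
  then show m [measurable]: "\<eta> \<in> borel_measurable borel"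
    by (rule borel_measurable_continuous_onI)
  have le: "\<bar>\<eta> a\<bar> \<le> \<bar>a\<bar>" for a using lip[of a 0] zero by simp
  show "integrable M (\<lambda>x. \<eta> (v x))" if "integrable M v"
    by (rule Bochner_Integration.integrable_bound[OF that])
      (use that le in \<open>auto intro: measurable_compose[OF _ m]\<close>)
  show "(\<lambda>x. \<eta> (u x)) \<in> L2_space" if "u \<in> L2_space"
    by (rule L2_space_bound[OF that measurable_compose[OF L2_space_measurable[OF that] m]])
      (use le in auto)
qed

text \<open>
  A map with Lipschitz constant \<open>1\<close> shrinks every single increment of \<open>u\<close>.
\<close>

lemma fractional_energy_Lipschitz_borel:
  fixes u :: "'a::euclidean_space \<Rightarrow> real"
  assumes s: "0 < s" "s < 1" and u1: "integrable lborel u" and u2: "u \<in> L2_space"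
    and lip: "\<And>a b. \<bar>\<eta> a - \<eta> b\<bar> \<le> \<bar>a - b\<bar>" and zero: "\<eta> 0 = 0"
  shows "fractional_energy s (\<lambda>x. \<eta> (u x)) \<le> fractional_energy s u"
proof -
  note comp = Lipschitz_compose[OF lip zero]
  have "(\<eta> a - \<eta> b)\<^sup>2 \<le> (a - b)\<^sup>2" for a b
    using lip[of a b] by (simp add: abs_le_square_iff)
  then have "symbol_const TYPE('a) s * fractional_energy s (\<lambda>x. \<eta> (u x)) \<le> symbol_const TYPE('a) s * fractional_energy s u"
    unfolding fractional_energy_jump[OF u1 u2 s(1)] fractional_energy_jump[OF comp(2)[OF u1] comp(3)[OF u2] s(1)]
    by (intro nn_integral_mono mult_left_mono ennreal_leI) auto
  then show ?thesis
    by (subst (asm) ennreal_mult_le_mult_iff) (auto simp: symbol_const_pos symbol_const_finite[OF s])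
qed

theorem fractional_energy_Lipschitz:
  fixes u :: "'a::euclidean_space \<Rightarrow> real"
  assumes s: "0 < s" "s < 1" and u1: "integrable lebesgue u" and u2: "u \<in> L2_space"
    and lip: "\<And>a b. \<bar>\<eta> a - \<eta> b\<bar> \<le> \<bar>a - b\<bar>" and zero: "\<eta> 0 = 0"
  shows "fractional_energy s (\<lambda>x. \<eta> (u x)) \<le> fractional_energy s u"
proof -
  note um = L2_space_measurable[OF u2]
  obtain v where v: "v \<in> borel_measurable lborel" and eq: "AE x in lborel. u x = v x"
    using completion_ex_borel_measurable_real[OF um] by blast
  have eq: "AE x in lebesgue. u x = v x" using eq by (rule AE_completion)
  have vm: "v \<in> borel_measurable lebesgue" using v by (simp add: measurable_completion)
  have v1: "integrable lborel v"
    using u1 integrable_cong_AE[OF um vm eq] v by (simp add: integrable_completion)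
  have v2: "v \<in> L2_space"
    by (rule L2_space_cong_AE[OF u2 vm]) (use eq in eventually_elim, simp)
  note m = Lipschitz_compose(1)[of \<eta>, OF lip zero]
  have "fractional_energy s (\<lambda>x. \<eta> (u x)) = fractional_energy s (\<lambda>x. \<eta> (v x))"
    by (rule fractional_energy_cong_AE[OF measurable_compose[OF um m] measurable_compose[OF vm m]])
      (use eq in eventually_elim, simp)
  also have "\<dots> \<le> fractional_energy s v"
    by (rule fractional_energy_Lipschitz_borel[OF s v1 v2 lip zero])
  also have "\<dots> = fractional_energy s u"
    by (rule fractional_energy_cong_AE[OF vm um]) (use eq in eventually_elim, simp)
  finally show ?thesis .
qed

section \<open>The fractional Laplacian on functions with bounded support\<close>

abbreviation fourier_real :: "('a::euclidean_space \<Rightarrow> real) \<Rightarrow> 'a \<Rightarrow> complex" where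
  "fourier_real u \<equiv> fourier_integral (\<lambda>x. complex_of_real (u x))"

lemma fourier_real_borel:
  fixes u :: "'a::euclidean_space \<Rightarrow> real"
  assumes u: "u \<in> borel_measurable lebesgue"
  shows "fourier_real u \<in> borel_measurable borel"
proof -
  have U: "(\<lambda>x. complex_of_real (u x)) \<in> borel_measurable lebesgue" using u by measurable
  obtain g where g [measurable]: "g \<in> borel_measurable borel"
    and eq: "AE x in lebesgue. complex_of_real (u x) = g x"
    using lebesgue_measurable_ex_borel_complex[OF U] .
  have "fourier_real u = fourier_integral g"
    by (intro ext fourier_integral_cong_AE U eq) (simp add: measurable_completion)
  then show ?thesis by simp
qed

lemma fourier_real_Hermitian: "fourier_real u (- \<xi>) = cnj (fourier_real u \<xi>)"
  unfolding fourier_integral_def complex_cnj_scaleR Bochner_Integration.integral_cnj[symmetric]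
  by (simp add: cis_cnj)

lemma is_fourier_L2_real:
  fixes u :: "'a::euclidean_space \<Rightarrow> real"
  assumes "integrable lebesgue u" "u \<in> L2_space"
  shows "is_fourier_L2 (\<lambda>x. complex_of_real (u x)) (fourier_real u)"
  by (rule is_fourier_L2_fourier_integral) (use assms in \<open>simp_all add: L2_of_real_iff\<close>)

text \<open>
  The Fourier transform of \<open>(-\<Delta>)\<^sup>s\<^sup>/\<^sup>2 u\<close>.
\<close>

definition symbol :: "real \<Rightarrow> ('a::euclidean_space \<Rightarrow> real) \<Rightarrow> 'a \<Rightarrow> complex" where
  "symbol s u \<xi> = norm \<xi> powr s *\<^sub>R fourier_real u \<xi>"

lemma symbol_borel:
  assumes "u \<in> borel_measurable lebesgue" shows "symbol s u \<in> borel_measurable borel"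
  unfolding symbol_def[abs_def] using fourier_real_borel[OF assms] by measurable

lemma fractional_energy_symbol:
  "fractional_energy s u = (\<integral>\<^sup>+\<xi>. ennreal ((norm (symbol s u \<xi>))\<^sup>2) \<partial>lebesgue)"
  by (simp add: fractional_energy_def symbol_def)

text \<open>
  By uniqueness of the transform, the \<open>L\<^sup>2\<close> transform of an integrable \<open>u\<close> that occurs in the
  definition is its Fourier integral.
\<close>

lemma is_frac_laplacian_iff:
  fixes u w :: "'a::euclidean_space \<Rightarrow> real"
  assumes u1: "integrable lebesgue u" and u2: "u \<in> L2_space"
  shows "is_frac_laplacian (s / 2) u w \<longleftrightarrow> is_fourier_L2 (\<lambda>x. complex_of_real (w x)) (symbol s u)"
proof
  note F = is_fourier_L2_real[OF u1 u2]
  assume "is_frac_laplacian (s / 2) u w"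
  then obtain g where g: "is_fourier_L2 (\<lambda>x. complex_of_real (u x)) g"
    and w: "is_fourier_L2 (\<lambda>x. complex_of_real (w x)) (\<lambda>\<xi>. norm \<xi> powr s *\<^sub>R g \<xi>)"
    by (auto simp: is_frac_laplacian_def)
  have "AE \<xi> in lebesgue. fourier_real u \<xi> = g \<xi>"
    using is_fourier_L2_AE_eq_iff[OF F g] by simp
  then have "AE \<xi> in lebesgue. symbol s u \<xi> = norm \<xi> powr s *\<^sub>R g \<xi>"
    by eventually_elim (simp add: symbol_def)
  moreover have "(\<lambda>x. complex_of_real (w x)) \<in> borel_measurable lebesgue"
    using w by (simp add: is_fourier_L2_iff L2_space_measurable)
  moreover have "symbol s u \<in> borel_measurable lebesgue"
    using symbol_borel[OF L2_space_measurable[OF u2]] by (simp add: measurable_completion)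
  ultimately show "is_fourier_L2 (\<lambda>x. complex_of_real (w x)) (symbol s u)"
    using w by (intro is_fourier_L2_cong[OF w]) auto
next
  assume "is_fourier_L2 (\<lambda>x. complex_of_real (w x)) (symbol s u)"
  then show "is_frac_laplacian (s / 2) u w"
    using is_fourier_L2_real[OF u1 u2]
    by (auto simp: is_frac_laplacian_def symbol_def[abs_def] intro!: exI[of _ "fourier_real u"])
qed

text \<open>
  If the energy is finite then \<open>symbol s u\<close> is square-integrable, and it is Hermitian because \<open>u\<close> is
  real. Surjectivity of the transform then provides the real function \<open>(-\<Delta>)\<^sup>s\<^sup>/\<^sup>2 u\<close>.
\<close>

lemma Hs_iff_fractional_energy:
  fixes u :: "'a::euclidean_space \<Rightarrow> real"
  assumes u1: "integrable lebesgue u" and u2: "u \<in> L2_space"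
  shows "u \<in> Hs s \<longleftrightarrow> fractional_energy s u < \<infinity>"
proof
  assume "u \<in> Hs s"
  then have "symbol s u \<in> L2_space"
    using is_frac_laplacian_iff[OF u1 u2] by (auto simp: Hs_def is_fourier_L2_iff)
  then show "fractional_energy s u < \<infinity>"
    by (simp add: fractional_energy_symbol L2_space_iff_nn_integral)
next
  note m = symbol_borel[OF L2_space_measurable[OF u2], of s]
  assume "fractional_energy s u < \<infinity>"
  then have "symbol s u \<in> L2_space"
    using m by (simp add: fractional_energy_symbol L2_space_iff_nn_integral measurable_completion)
  moreover have "symbol s u (- \<xi>) = cnj (symbol s u \<xi>)" for \<xi>
    by (simp add: symbol_def fourier_real_Hermitian)
  ultimately obtain w where "w \<in> L2_space" "is_fourier_L2 (\<lambda>x. complex_of_real (w x)) (symbol s u)"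
    using is_fourier_L2_surj[OF m] by metis
  then show "u \<in> Hs s"
    using is_frac_laplacian_iff[OF u1 u2] u2 by (auto simp: Hs_def)
qed

lemma frac_laplacian_fourier:
  fixes u :: "'a::euclidean_space \<Rightarrow> real"
  assumes u1: "integrable lebesgue u" and u: "u \<in> Hs s"
  shows "is_fourier_L2 (\<lambda>x. complex_of_real (frac_laplacian (s / 2) u x)) (symbol s u)"
proof -
  have u2: "u \<in> L2_space" and "\<exists>w. is_frac_laplacian (s / 2) u w" using u by (auto simp: Hs_def)
  then have "is_frac_laplacian (s / 2) u (frac_laplacian (s / 2) u)"
    unfolding frac_laplacian_def by (metis someI_ex)
  then show ?thesis by (simp add: is_frac_laplacian_iff[OF u1 u2])
qed

lemma frac_laplacian_L2:
  assumes "integrable lebesgue u" "u \<in> Hs s"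
  shows "frac_laplacian (s / 2) u \<in> L2_space"
  using frac_laplacian_fourier[OF assms] by (simp add: is_fourier_L2_iff L2_of_real_iff)

lemma frac_laplacian_energy:
  assumes "integrable lebesgue u" "u \<in> Hs s"
  shows "fractional_energy s u = ennreal ((L2_norm (frac_laplacian (s / 2) u))\<^sup>2)"
proof -
  note F = frac_laplacian_fourier[OF assms]
  have "symbol s u \<in> L2_space" using F by (simp add: is_fourier_L2_iff)
  then show ?thesis
    using is_fourier_L2_isometry[OF F]
    by (simp add: fractional_energy_symbol nn_integral_eq_L2_norm L2_norm_of_real)
qed

lemma frac_laplacian_add_scaleR:
  fixes u v :: "'a::euclidean_space \<Rightarrow> real"
  assumes u1: "integrable lebesgue u" and u: "u \<in> Hs s" and v1: "integrable lebesgue v" and v: "v \<in> Hs s"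
  shows "(\<lambda>x. u x + c * v x) \<in> Hs s"
    and "AE x in lebesgue. frac_laplacian (s / 2) (\<lambda>x. u x + c * v x) x
      = frac_laplacian (s / 2) u x + c * frac_laplacian (s / 2) v x"
proof -
  let ?w = "\<lambda>x. frac_laplacian (s / 2) u x + c * frac_laplacian (s / 2) v x"
  let ?uv = "\<lambda>x. u x + c * v x"
  have u2: "u \<in> L2_space" and v2: "v \<in> L2_space" using u v by (auto simp: Hs_def)
  have uv1: "integrable lebesgue ?uv" using u1 v1 by simp
  have uv2: "?uv \<in> L2_space" using L2_space_add[OF u2 L2_space_scaleR[OF v2, of c]] by simp
  have "fourier_real ?uv \<xi> = fourier_real u \<xi> + c *\<^sub>R fourier_real v \<xi>" for \<xi>
    using fourier_integral_add_scaleR[of "\<lambda>x. complex_of_real (u x)" "\<lambda>x. complex_of_real (v x)" c \<xi>] u1 v1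
    by (simp add: scaleR_conv_of_real)
  then have sym: "symbol s ?uv = (\<lambda>\<xi>. symbol s u \<xi> + c *\<^sub>R symbol s v \<xi>)"
    by (simp add: fun_eq_iff symbol_def scaleR_add_right mult.commute)
  have w: "is_fourier_L2 (\<lambda>x. complex_of_real (?w x)) (symbol s ?uv)"
    using is_fourier_L2_add_scaleR[OF frac_laplacian_fourier[OF u1 u] frac_laplacian_fourier[OF v1 v], of c]
    unfolding sym by (simp add: scaleR_conv_of_real)
  have "?w \<in> L2_space"
    using w by (simp only: is_fourier_L2_iff L2_of_real_iff)
  moreover have "is_frac_laplacian (s / 2) ?uv ?w"
    unfolding is_frac_laplacian_iff[OF uv1 uv2] by (rule w)
  ultimately show uv: "?uv \<in> Hs s"
    using uv2 by (auto simp: Hs_def)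
  show "AE x in lebesgue. frac_laplacian (s / 2) ?uv x = ?w x"
    using is_fourier_L2_AE_eq_iff[OF frac_laplacian_fourier[OF uv1 uv] w] by (simp del: of_real_add of_real_mult)
qed

text \<open>
  The factor \<open>norm \<xi> powr s\<close> vanishes only at the origin, so a vanishing \<open>symbol s u\<close> forces the
  transform of \<open>u\<close> to vanish almost everywhere.
\<close>

lemma frac_laplacian_eq_0:
  fixes u :: "'a::euclidean_space \<Rightarrow> real"
  assumes u1: "integrable lebesgue u" and u: "u \<in> Hs s"
    and zero: "L2_norm (frac_laplacian (s / 2) u) = 0"
  shows "AE x in lebesgue. u x = 0"
proof -
  have u2: "u \<in> L2_space" using u by (simp add: Hs_def)
  note F = frac_laplacian_fourier[OF u1 u]
  have "L2_norm (symbol s u) = 0"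
    using is_fourier_L2_isometry[OF F] zero by (simp add: L2_norm_of_real)
  then have "AE \<xi> in lebesgue. symbol s u \<xi> = 0"
    using F by (simp add: L2_norm_eq_0_iff_AE is_fourier_L2_iff)
  moreover have "AE \<xi> in lebesgue. \<xi> \<noteq> (0::'a)"
    by (intro AE_completion AE_lborel_singleton)
  ultimately have "AE \<xi> in lebesgue. fourier_real u \<xi> = 0"
    by eventually_elim (simp add: symbol_def)
  moreover have FU: "is_fourier_L2 (\<lambda>x. complex_of_real (u x)) (fourier_real u)"
    by (rule is_fourier_L2_real[OF u1 u2])
  ultimately have "L2_norm (fourier_real u) = 0"
    by (simp add: L2_norm_eq_0_iff_AE is_fourier_L2_iff)
  then have "L2_norm u = 0"
    using is_fourier_L2_isometry[OF FU] by (simp add: L2_norm_of_real)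
  then show ?thesis using u2 by (simp add: L2_norm_eq_0_iff_AE)
qed

section \<open>The energy form on the Dirichlet space\<close>

lemma Hs_tilde_integrable:
  assumes \<Omega>: "bounded \<Omega>" and u: "u \<in> Hs_tilde s \<Omega>"
  shows "integrable lebesgue u"
proof -
  have u2: "u \<in> L2_space" and ae: "AE x in lebesgue. x \<notin> closure \<Omega> \<longrightarrow> u x = 0"
    using u by (auto simp: Hs_tilde_def Hs_def)
  have "compact (closure \<Omega>)" using \<Omega> by (simp add: compact_closure)
  then have "integrable lebesgue (\<lambda>x. indicator (closure \<Omega>) x *\<^sub>R u x)"
    by (intro integrable_indicator_L2 u2 lmeasurable_compact)
  moreover have "AE x in lebesgue. indicator (closure \<Omega>) x *\<^sub>R u x = u x"
    using ae by eventually_elim (auto simp: indicator_def)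
  ultimately show ?thesis
    by (intro integrable_cong_AE_imp[OF _ L2_space_measurable[OF u2]])
qed

lemma Hs_tilde_Hs: "u \<in> Hs_tilde s \<Omega> \<Longrightarrow> u \<in> Hs s"
  by (simp add: Hs_tilde_def)

lemma Hs_tilde_add_scaleR:
  assumes \<Omega>: "bounded \<Omega>" and u: "u \<in> Hs_tilde s \<Omega>" and v: "v \<in> Hs_tilde s \<Omega>"
  shows "(\<lambda>x. u x + c * v x) \<in> Hs_tilde s \<Omega>"
proof -
  have "AE x in lebesgue. x \<notin> closure \<Omega> \<longrightarrow> u x = 0" "AE x in lebesgue. x \<notin> closure \<Omega> \<longrightarrow> v x = 0"
    using u v by (auto simp: Hs_tilde_def)
  then have "AE x in lebesgue. x \<notin> closure \<Omega> \<longrightarrow> u x + c * v x = 0"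
    by eventually_elim simp
  then show ?thesis
    using frac_laplacian_add_scaleR(1)[OF Hs_tilde_integrable[OF \<Omega> u] Hs_tilde_Hs[OF u]
        Hs_tilde_integrable[OF \<Omega> v] Hs_tilde_Hs[OF v]]
    by (simp add: Hs_tilde_def)
qed

text \<open>
  Finite energy characterises \<open>Hs s\<close> among the integrable functions in \<open>L\<^sup>2\<close>, so the contraction
  property of the energy yields membership and the bound on the norm at once.
\<close>

lemma Hs_tilde_Lipschitz:
  assumes s: "0 < s" "s < 1" and \<Omega>: "bounded \<Omega>" and u: "u \<in> Hs_tilde s \<Omega>"
    and lip: "\<And>a b. \<bar>\<eta> a - \<eta> b\<bar> \<le> \<bar>a - b\<bar>" and zero: "\<eta> 0 = 0"
  shows "(\<lambda>x. \<eta> (u x)) \<in> Hs_tilde s \<Omega>"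
    and "L2_norm (frac_laplacian (s / 2) (\<lambda>x. \<eta> (u x))) \<le> L2_norm (frac_laplacian (s / 2) u)"
proof -
  let ?v = "\<lambda>x. \<eta> (u x)"
  note u1 = Hs_tilde_integrable[OF \<Omega> u] and uH = Hs_tilde_Hs[OF u]
  have u2: "u \<in> L2_space" using uH by (simp add: Hs_def)
  have v1: "integrable lebesgue ?v" and v2: "?v \<in> L2_space"
    by (rule Lipschitz_compose[of \<eta>, OF lip zero] u1 u2)+
  have le: "fractional_energy s ?v \<le> fractional_energy s u"
    by (rule fractional_energy_Lipschitz[OF s u1 u2 lip zero])
  then have vH: "?v \<in> Hs s"
    using uH by (simp add: Hs_iff_fractional_energy[OF u1 u2] Hs_iff_fractional_energy[OF v1 v2] le_less_trans)
  moreover have "AE x in lebesgue. x \<notin> closure \<Omega> \<longrightarrow> u x = 0"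
    using u by (simp add: Hs_tilde_def)
  then have "AE x in lebesgue. x \<notin> closure \<Omega> \<longrightarrow> ?v x = 0"
    by eventually_elim (simp add: zero)
  ultimately show "?v \<in> Hs_tilde s \<Omega>" by (simp add: Hs_tilde_def)
  show "L2_norm (frac_laplacian (s / 2) ?v) \<le> L2_norm (frac_laplacian (s / 2) u)"
    using le unfolding frac_laplacian_energy[OF u1 uH] frac_laplacian_energy[OF v1 vH]
    by (simp add: L2_norm_nonneg)
qed

lemma frac_laplacian_dual_eq_inner:
  "frac_laplacian_dual s u v = L2_inner (frac_laplacian (s / 2) u) (frac_laplacian (s / 2) v)"
  by (simp add: frac_laplacian_dual_def L2_inner_def)

lemma frac_laplacian_dual_commute: "frac_laplacian_dual s u v = frac_laplacian_dual s v u"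
  by (simp add: frac_laplacian_dual_eq_inner L2_inner_commute)

lemma frac_laplacian_dual_add_scaleR:
  assumes \<Omega>: "bounded \<Omega>" and u: "u \<in> Hs_tilde s \<Omega>" and v: "v \<in> Hs_tilde s \<Omega>" and w: "w \<in> Hs_tilde s \<Omega>"
  shows "frac_laplacian_dual s (\<lambda>x. u x + c * v x) w
    = frac_laplacian_dual s u w + c * frac_laplacian_dual s v w"
proof -
  let ?L = "frac_laplacian (s / 2)"
  note int = Hs_tilde_integrable[OF \<Omega>]
  have L: "?L z \<in> L2_space" if "z \<in> Hs_tilde s \<Omega>" for z
    by (rule frac_laplacian_L2[OF int[OF that] Hs_tilde_Hs[OF that]])
  note uv = Hs_tilde_add_scaleR[OF \<Omega> u v, of c]
  have "L2_inner (?L (\<lambda>x. u x + c * v x)) (?L w) = L2_inner (\<lambda>x. ?L u x + c *\<^sub>R ?L v x) (?L w)"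
    unfolding L2_inner_def
  proof (rule integral_cong_AE)
    show "AE x in lebesgue. ?L (\<lambda>x. u x + c * v x) x \<bullet> ?L w x = (?L u x + c *\<^sub>R ?L v x) \<bullet> ?L w x"
      using frac_laplacian_add_scaleR(2)[OF int[OF u] Hs_tilde_Hs[OF u] int[OF v] Hs_tilde_Hs[OF v], of c]
      by eventually_elim simp
  qed (use integrable_L2_inner[OF L[OF uv] L[OF w]]
        integrable_L2_inner[OF L2_space_add[OF L[OF u] L2_space_scaleR[OF L[OF v], of c]] L[OF w]] in auto)
  also have "\<dots> = L2_inner (?L u) (?L w) + c * L2_inner (?L v) (?L w)"
    using L2_inner_add_left[OF L[OF u] L2_space_scaleR[OF L[OF v], of c] L[OF w]]
    by (simp only: L2_inner_scaleR_left)
  finally show ?thesis by (simp add: frac_laplacian_dual_eq_inner)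
qed

text \<open>
  The multiple \<open>c * v\<close> is written as \<open>v + (c - 1) * v\<close> to obtain homogeneity from the previous lemma.
\<close>

lemma frac_laplacian_dual_scaleR:
  assumes \<Omega>: "bounded \<Omega>" and v: "v \<in> Hs_tilde s \<Omega>" and w: "w \<in> Hs_tilde s \<Omega>"
  shows "frac_laplacian_dual s (\<lambda>x. c * v x) w = c * frac_laplacian_dual s v w"
proof -
  have "(\<lambda>x. v x + (c - 1) * v x) = (\<lambda>x. c * v x)" by (simp add: algebra_simps)
  then show ?thesis
    using frac_laplacian_dual_add_scaleR[OF \<Omega> v v w, of "c - 1"] by (simp add: algebra_simps)
qed

lemma frac_laplacian_dual_self:
  "frac_laplacian_dual s u u = (L2_norm (frac_laplacian (s / 2) u))\<^sup>2"
  by (simp add: frac_laplacian_dual_eq_inner L2_norm_power2)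

text \<open>
  The reflection \<open>t \<mapsto> t - 2 * max (t - M) 0\<close> at the level \<open>M\<close> has Lipschitz constant \<open>1\<close> and fixes
  \<open>0\<close>, so \<open>w - 2\<phi>\<close> has at most the energy of \<open>w\<close>. Expanding \<open>E(w - 2\<phi>, w - 2\<phi>) \<le> E(w, w)\<close> leaves
  exactly \<open>E(\<phi>, \<phi>) \<le> E(w, \<phi>)\<close>.
\<close>

lemma frac_laplacian_dual_excess:
  assumes s: "0 < s" "s < 1" and \<Omega>: "bounded \<Omega>" and w: "w \<in> Hs_tilde s \<Omega>" and M: "0 \<le> M"
  defines "\<phi> \<equiv> \<lambda>x. max (w x - M) 0"
  shows "\<phi> \<in> Hs_tilde s \<Omega>" and "frac_laplacian_dual s \<phi> \<phi> \<le> frac_laplacian_dual s w \<phi>"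
proof -
  let ?E = "frac_laplacian_dual s"
  have lip: "\<bar>max (a - M) 0 - max (b - M) 0\<bar> \<le> \<bar>a - b\<bar>"
    "\<bar>(a + (- 2) * max (a - M) 0) - (b + (- 2) * max (b - M) 0)\<bar> \<le> \<bar>a - b\<bar>" for a b :: real
    by (simp_all add: max_def abs_if)
  show \<phi>: "\<phi> \<in> Hs_tilde s \<Omega>"
    unfolding \<phi>_def by (rule Hs_tilde_Lipschitz(1)[OF s \<Omega> w lip(1)]) (use M in simp)
  let ?r = "\<lambda>x. w x + (- 2) * \<phi> x"
  note r = Hs_tilde_add_scaleR[OF \<Omega> w \<phi>, of "- 2"]
  have "L2_norm (frac_laplacian (s / 2) ?r) \<le> L2_norm (frac_laplacian (s / 2) w)"
    unfolding \<phi>_def by (rule Hs_tilde_Lipschitz(2)[OF s \<Omega> w lip(2)]) (use M in simp)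
  then have "?E ?r ?r \<le> ?E w w"
    unfolding frac_laplacian_dual_self by (intro power_mono L2_norm_nonneg)
  moreover have "?E ?r ?r = ?E w w - 4 * ?E w \<phi> + 4 * ?E \<phi> \<phi>"
  proof -
    have "?E ?r ?r = ?E w ?r + (- 2) * ?E \<phi> ?r"
      by (rule frac_laplacian_dual_add_scaleR[OF \<Omega> w \<phi> r])
    moreover have "?E w ?r = ?E w w + (- 2) * ?E \<phi> w"
      unfolding frac_laplacian_dual_commute[of s w ?r]
      by (rule frac_laplacian_dual_add_scaleR[OF \<Omega> w \<phi> w])
    moreover have "?E \<phi> ?r = ?E w \<phi> + (- 2) * ?E \<phi> \<phi>"
      unfolding frac_laplacian_dual_commute[of s \<phi> ?r]
      by (rule frac_laplacian_dual_add_scaleR[OF \<Omega> w \<phi> \<phi>])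
    ultimately show ?thesis
      using frac_laplacian_dual_commute[of s \<phi> w] by linarith
  qed
  ultimately show "?E \<phi> \<phi> \<le> ?E w \<phi>" by simp
qed

section \<open>Comparison of solutions\<close>

text \<open>
  Where \<open>\<phi> = max (u1 - u2 - M) 0\<close> is positive, \<open>u1 - \<phi> = u2 + M \<ge> \<psi>2 + M \<ge> \<psi>1\<close>; therefore \<open>u1 - \<phi>\<close> is
  admissible for \<open>\<psi>1\<close>, and \<open>u2 + \<phi>\<close> is admissible for \<open>\<psi>2\<close>. The two variational inequalities add up
  to \<open>E(u1 - u2, \<phi>) \<le> 0\<close>.
\<close>

lemma obstacle_comparison:
  fixes \<Omega> :: "'a::euclidean_space set"
  assumes s: "0 < s" "s < 1" and \<Omega>: "open \<Omega>" "bounded \<Omega>" and f: "f \<in> Hs_tilde_dual s \<Omega>"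
    and sol1: "solves_obstacle_problem s \<Omega> \<psi>1 f u1" and sol2: "solves_obstacle_problem s \<Omega> \<psi>2 f u2"
    and M: "0 \<le> M" and \<psi>: "AE x in lebesgue_on \<Omega>. \<psi>1 x - \<psi>2 x \<le> M"
  shows "AE x in lebesgue_on \<Omega>. u1 x - u2 x \<le> M"
proof -
  let ?E = "frac_laplacian_dual s"
  have K1: "u1 \<in> K_obstacle s \<Omega> \<psi>1" and K2: "u2 \<in> K_obstacle s \<Omega> \<psi>2"
    using sol1 sol2 by (auto simp: solves_obstacle_problem_def)
  then have u1: "u1 \<in> Hs_tilde s \<Omega>" and u2: "u2 \<in> Hs_tilde s \<Omega>"
    and ge1: "AE x in lebesgue_on \<Omega>. \<psi>1 x \<le> u1 x" and ge2: "AE x in lebesgue_on \<Omega>. \<psi>2 x \<le> u2 x"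
    by (auto simp: K_obstacle_def)
  define w where "w x = u1 x + (- 1) * u2 x" for x
  have w: "w \<in> Hs_tilde s \<Omega>"
    unfolding w_def[abs_def] by (rule Hs_tilde_add_scaleR[OF \<Omega>(2) u1 u2])
  define \<phi> where "\<phi> x = max (w x - M) 0" for x
  have \<phi>: "\<phi> \<in> Hs_tilde s \<Omega>" and excess: "?E \<phi> \<phi> \<le> ?E w \<phi>"
    unfolding \<phi>_def[abs_def] by (rule frac_laplacian_dual_excess[OF s \<Omega>(2) w M])+
  have v1: "(\<lambda>x. u1 x + (- 1) * \<phi> x) \<in> K_obstacle s \<Omega> \<psi>1"
    unfolding K_obstacle_def
  proof (intro CollectI conjI Hs_tilde_add_scaleR[OF \<Omega>(2) u1 \<phi>])
    show "AE x in lebesgue_on \<Omega>. \<psi>1 x \<le> u1 x + (- 1) * \<phi> x"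
      using ge1 ge2 \<psi> by eventually_elim (auto simp: \<phi>_def w_def max_def)
  qed
  have v2: "(\<lambda>x. u2 x + 1 * \<phi> x) \<in> K_obstacle s \<Omega> \<psi>2"
    unfolding K_obstacle_def
  proof (intro CollectI conjI Hs_tilde_add_scaleR[OF \<Omega>(2) u2 \<phi>])
    show "AE x in lebesgue_on \<Omega>. \<psi>2 x \<le> u2 x + 1 * \<phi> x"
      using ge2 by eventually_elim (auto simp: \<phi>_def)
  qed
  have f_minus: "f (\<lambda>x. (- 1) * \<phi> x) = (- 1) * f \<phi>"
    using f \<phi> unfolding Hs_tilde_dual_def by blast
  have "0 \<le> ?E u1 (\<lambda>x. (- 1) * \<phi> x) - f (\<lambda>x. (- 1) * \<phi> x)"
    using sol1 v1 unfolding solves_obstacle_problem_def by fastforce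
  then have 1: "?E u1 \<phi> \<le> f \<phi>"
    using frac_laplacian_dual_scaleR[OF \<Omega>(2) \<phi> u1, of "- 1"]
    unfolding f_minus by (simp add: frac_laplacian_dual_commute[of s u1])
  have 2: "f \<phi> \<le> ?E u2 \<phi>"
    using sol2 v2 unfolding solves_obstacle_problem_def by fastforce
  have "?E w \<phi> = ?E u1 \<phi> - ?E u2 \<phi>"
    unfolding w_def[abs_def] using frac_laplacian_dual_add_scaleR[OF \<Omega>(2) u1 u2 \<phi>, of "- 1"] by simp
  with excess 1 2 have "?E \<phi> \<phi> \<le> 0" by linarith
  then have "L2_norm (frac_laplacian (s / 2) \<phi>) = 0"
    by (simp add: frac_laplacian_dual_self)
  then have "AE x in lebesgue. \<phi> x = 0"
    by (rule frac_laplacian_eq_0[OF Hs_tilde_integrable[OF \<Omega>(2) \<phi>] Hs_tilde_Hs[OF \<phi>]])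
  then have "AE x in lebesgue. x \<in> \<Omega> \<longrightarrow> u1 x - u2 x \<le> M"
    by eventually_elim (auto simp: \<phi>_def w_def max_def split: if_splits)
  then show ?thesis
    using \<Omega>(1) by (subst AE_restrict_space_iff) auto
qed

text \<open>
  On a null set the essential supremum is \<open>- \<infinity>\<close>; a nonempty open set is not null.
\<close>

lemma Linf_norm_nonneg:
  assumes \<Omega>: "open \<Omega>" "\<Omega> \<noteq> {}" shows "0 \<le> Linf_norm \<Omega> g"
proof -
  have "\<not> negligible \<Omega>" using \<Omega> by (rule open_not_negligible)
  then have "emeasure (lebesgue_on \<Omega>) (space (lebesgue_on \<Omega>)) \<noteq> 0"
    using \<Omega>(1) by (simp add: emeasure_restrict_space negligible_iff_emeasure0 space_restrict_space)
  then have "esssup (lebesgue_on \<Omega>) (\<lambda>x. 0 :: ereal) = 0" by (rule esssup_const)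
  moreover have "esssup (lebesgue_on \<Omega>) (\<lambda>x. 0 :: ereal) \<le> esssup (lebesgue_on \<Omega>) (\<lambda>x. ereal \<bar>g x\<bar>)"
    by (rule esssup_mono) auto
  ultimately show ?thesis by (simp add: Linf_norm_def)
qed

lemma AE_le_Linf_norm: "AE x in lebesgue_on \<Omega>. ereal \<bar>g x\<bar> \<le> Linf_norm \<Omega> g"
  unfolding Linf_norm_def by (rule esssup_AE)

lemma Linf_norm_le:
  assumes "g \<in> borel_measurable (lebesgue_on \<Omega>)" "AE x in lebesgue_on \<Omega>. \<bar>g x\<bar> \<le> M"
  shows "Linf_norm \<Omega> g \<le> ereal M"
  unfolding Linf_norm_def by (rule esssup_I) (use assms in auto)

lemma obstacle_positive_part:
  fixes \<Omega> :: "'a::euclidean_space set"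
  assumes s: "0 < s" "s < 1" and \<Omega>: "open \<Omega>" "\<Omega> \<noteq> {}" "bounded \<Omega>" and f: "f \<in> Hs_tilde_dual s \<Omega>"
    and sol1: "solves_obstacle_problem s \<Omega> \<psi>1 f u1" and sol2: "solves_obstacle_problem s \<Omega> \<psi>2 f u2"
    and \<psi>: "(\<lambda>x. \<psi>1 x - \<psi>2 x) \<in> Linf_space \<Omega>"
  obtains M where "0 \<le> M" "Linf_norm \<Omega> (\<lambda>x. max (\<psi>1 x - \<psi>2 x) 0) = ereal M"
    "AE x in lebesgue_on \<Omega>. u1 x - u2 x \<le> M"
proof -
  let ?N = "Linf_norm \<Omega> (\<lambda>x. max (\<psi>1 x - \<psi>2 x) 0)"
  have m: "(\<lambda>x. \<psi>1 x - \<psi>2 x) \<in> borel_measurable (lebesgue_on \<Omega>)"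
    and fin: "Linf_norm \<Omega> (\<lambda>x. \<psi>1 x - \<psi>2 x) < \<infinity>"
    using \<psi> by (auto simp: Linf_space_def)
  have "?N \<le> Linf_norm \<Omega> (\<lambda>x. \<psi>1 x - \<psi>2 x)"
    unfolding Linf_norm_def by (rule esssup_mono) (use m in auto)
  with fin have "?N < \<infinity>" by (rule le_less_trans[rotated])
  moreover have "0 \<le> ?N" by (rule Linf_norm_nonneg[OF \<Omega>(1,2)])
  ultimately obtain M where M: "?N = ereal M" "0 \<le> M" by (cases ?N) auto
  have "AE x in lebesgue_on \<Omega>. \<psi>1 x - \<psi>2 x \<le> M"
    using AE_le_Linf_norm[of "\<lambda>x. max (\<psi>1 x - \<psi>2 x) 0" \<Omega>] unfolding M(1) by eventually_elim auto
  from that[OF M(2,1) obstacle_comparison[OF s \<Omega>(1,3) f sol1 sol2 M(2) this]] show thesis .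
qed

theorem theorem4p1:
  fixes s :: real and \<Omega> :: "(real ^ 'n) set"
    and \<psi>1 \<psi>2 u1 u2 :: "real ^ 'n \<Rightarrow> real"
    and f :: "(real ^ 'n \<Rightarrow> real) \<Rightarrow> real"
  assumes "0 < s" and "s < 1"
    and "open \<Omega>" and "connected \<Omega>" and "\<Omega> \<noteq> {}" and "bounded \<Omega>"
    and "\<psi>1 \<in> borel_measurable (lebesgue_on \<Omega>)"
    and "\<psi>2 \<in> borel_measurable (lebesgue_on \<Omega>)"
    and "K_obstacle s \<Omega> \<psi>1 \<noteq> {}" and "K_obstacle s \<Omega> \<psi>2 \<noteq> {}"
    and "f \<in> Hs_tilde_dual s \<Omega>"
    and "solves_obstacle_problem s \<Omega> \<psi>1 f u1"
    and "solves_obstacle_problem s \<Omega> \<psi>2 f u2"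
    and "(\<lambda>x. \<psi>1 x - \<psi>2 x) \<in> Linf_space \<Omega>"
  shows "(\<lambda>x. u1 x - u2 x) \<in> Linf_space \<Omega> \<and>
    Linf_norm \<Omega> (\<lambda>x. max (u1 x - u2 x) 0) \<le> Linf_norm \<Omega> (\<lambda>x. max (\<psi>1 x - \<psi>2 x) 0) \<and>
    Linf_norm \<Omega> (\<lambda>x. - min (u1 x - u2 x) 0) \<le> Linf_norm \<Omega> (\<lambda>x. - min (\<psi>1 x - \<psi>2 x) 0)"
proof -
  have neg_part: "(\<lambda>x. - min (a x - b x) 0) = (\<lambda>x. max (b x - a x) 0)" for a b :: "real ^ 'n \<Rightarrow> real"
    by (auto simp: fun_eq_iff min_def max_def)
  have "(\<lambda>x. \<psi>2 x - \<psi>1 x) = (\<lambda>x. - (\<psi>1 x - \<psi>2 x))" by simp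
  then have \<psi>': "(\<lambda>x. \<psi>2 x - \<psi>1 x) \<in> Linf_space \<Omega>"
    using assms(7,8,14) by (auto simp: Linf_space_def Linf_norm_def abs_minus_commute)
  obtain M where M: "0 \<le> M" "Linf_norm \<Omega> (\<lambda>x. max (\<psi>1 x - \<psi>2 x) 0) = ereal M"
    and ub: "AE x in lebesgue_on \<Omega>. u1 x - u2 x \<le> M"
    using obstacle_positive_part[OF assms(1,2,3,5,6,11,12,13,14)] .
  obtain M' where M': "0 \<le> M'" "Linf_norm \<Omega> (\<lambda>x. max (\<psi>2 x - \<psi>1 x) 0) = ereal M'"
    and lb: "AE x in lebesgue_on \<Omega>. u2 x - u1 x \<le> M'"
    using obstacle_positive_part[OF assms(1,2,3,5,6,11,13,12) \<psi>'] .
  have "u1 \<in> borel_measurable lebesgue" "u2 \<in> borel_measurable lebesgue"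
    using assms(12,13)
    by (auto simp: solves_obstacle_problem_def K_obstacle_def Hs_tilde_def Hs_def L2_space_measurable)
  then have [measurable]: "u1 \<in> borel_measurable (lebesgue_on \<Omega>)" "u2 \<in> borel_measurable (lebesgue_on \<Omega>)"
    by (simp_all add: measurable_restrict_space1)
  have "Linf_norm \<Omega> (\<lambda>x. max (u1 x - u2 x) 0) \<le> ereal M"
  proof (rule Linf_norm_le)
    show "AE x in lebesgue_on \<Omega>. \<bar>max (u1 x - u2 x) 0\<bar> \<le> M"
      using ub by eventually_elim (use M(1) in simp)
  qed measurable
  moreover have "Linf_norm \<Omega> (\<lambda>x. max (u2 x - u1 x) 0) \<le> ereal M'"
  proof (rule Linf_norm_le)
    show "AE x in lebesgue_on \<Omega>. \<bar>max (u2 x - u1 x) 0\<bar> \<le> M'"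
      using lb by eventually_elim (use M'(1) in simp)
  qed measurable
  moreover have "Linf_norm \<Omega> (\<lambda>x. u1 x - u2 x) \<le> ereal (max M M')"
  proof (rule Linf_norm_le)
    show "AE x in lebesgue_on \<Omega>. \<bar>u1 x - u2 x\<bar> \<le> max M M'"
      using ub lb by eventually_elim (simp add: max_def abs_if)
  qed measurable
  then have "(\<lambda>x. u1 x - u2 x) \<in> Linf_space \<Omega>"
  proof -
    assume "Linf_norm \<Omega> (\<lambda>x. u1 x - u2 x) \<le> ereal (max M M')"
    also have "\<dots> < \<infinity>" by (simp only: less_ereal.simps)
    finally show ?thesis by (simp add: Linf_space_def)
  qed
  ultimately show ?thesis unfolding neg_part M(2) M'(2) by blast
qed

end
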